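(* Let $L$ be one of the calculi $\mathrm{gTK}$, $\mathrm{gTKT}$, or $\mathrm{HTS5}$ defined in the context. Then the rule (cut) of $L$ is admissible in cut-free $L$; that is, every (hyper)sequent provable in $L$ is provable in $L$ without using (cut).
   Context: Formulas are built from countably many propositional variables using the binary connectives $\wedge,\vee,\to$ and the unary connectives $\neg,\Box,\Diamond$. Letters $\Gamma,\Delta,\Sigma,\Pi$ (possibly with subscripts) denote finite, possibly empty, sets of formulas; a sequent is an expression $\Gamma\Rightarrow\Delta$; a comma denotes union. For a word $w$ over $\{\neg,\Box,\Diamond\}$, $w\Gamma=\{w\gamma:\gamma\in\Gamma\}$. A rule "$S_1;\dots;S_n\,/\,S$" has premises $S_1,\dots,S_n$ and conclusion $S$. "Cut-free $L$" means $L$ with (cut) removed; a rule is admissible in a calculus $M$ if whenever all premises of an instance are provable in $M$, so is its conclusion. gTK. Initial sequents: for every propositional variable $p$: $p\Rightarrow p$, $\neg p\Rightarrow\neg p$, $\neg p,p\Rightarrow$, $\Rightarrow\neg p,p$. Rules: (cut) $\Gamma\Rightarrow\alpha$; $\alpha,\Gamma\Rightarrow\Delta$ / $\Gamma\Rightarrow\Delta$. (we-left) $\Gamma\Rightarrow\Delta$ / $\alpha,\Gamma\Rightarrow\Delta$. (we-right) $\Gamma\Rightarrow\Delta$ / $\Gamma\Rightarrow\Delta,\alpha$. ($\wedge$left) $\alpha,\beta,\Gamma\Rightarrow\Delta$ / $\alpha\wedge\beta,\Gamma\Rightarrow\Delta$. ($\wedge$right) $\Gamma\Rightarrow\Delta,\alpha$;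 $\Gamma\Rightarrow\Delta,\beta$ / $\Gamma\Rightarrow\Delta,\alpha\wedge\beta$. ($\vee$left) $\alpha,\Gamma\Rightarrow\Delta$; $\beta,\Gamma\Rightarrow\Delta$ / $\alpha\vee\beta,\Gamma\Rightarrow\Delta$. ($\vee$right) $\Gamma\Rightarrow\Delta,\alpha,\beta$ / $\Gamma\Rightarrow\Delta,\alpha\vee\beta$. ($\to$left) $\Gamma\Rightarrow\Delta,\alpha$; $\beta,\Gamma\Rightarrow\Delta$ / $\alpha\to\beta,\Gamma\Rightarrow\Delta$. ($\to$right) $\alpha,\Gamma\Rightarrow\Delta,\beta$ / $\Gamma\Rightarrow\Delta,\alpha\to\beta$. ($\neg\neg$left$^t$) $\alpha,\Gamma\Rightarrow\Delta$ / $\neg\neg\alpha,\Gamma\Rightarrow\Delta$. ($\neg\neg$right$^t$) $\Gamma\Rightarrow\Delta,\alpha$ / $\Gamma\Rightarrow\Delta,\neg\neg\alpha$. ($\neg\wedge$left$^t$) $\Gamma\Rightarrow\Delta,\alpha$; $\Gamma\Rightarrow\Delta,\beta$ / $\neg(\alpha\wedge\beta),\Gamma\Rightarrow\Delta$. ($\neg\wedge$right$^t$) $\alpha,\beta,\Gamma\Rightarrow\Delta$ / $\Gamma\Rightarrow\Delta,\neg(\alpha\wedge\beta)$. ($\neg\vee$left$^t$) $\Gamma\Rightarrow\Delta,\alpha,\beta$ / $\neg(\alpha\vee\beta),\Gamma\Rightarrow\Delta$. ($\neg\vee$right$^t$) $\alpha,\Gamma\Rightarrow\Delta$; $\beta,\Gamma\Rightarrow\Delta$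 / $\Gamma\Rightarrow\Delta,\neg(\alpha\vee\beta)$. ($\neg\to$left$^t$) $\alpha,\Gamma\Rightarrow\Delta,\beta$ / $\neg(\alpha\to\beta),\Gamma\Rightarrow\Delta$. ($\neg\to$right$^t$) $\Gamma\Rightarrow\Delta,\alpha$; $\beta,\Gamma\Rightarrow\Delta$ / $\Gamma\Rightarrow\Delta,\neg(\alpha\to\beta)$. ($\Box$K-right$^T$) $\Gamma_1,\Delta_2\Rightarrow\Delta_1,\Gamma_2,\alpha$ / $\Box\Gamma_1,\neg\Diamond\Gamma_2\Rightarrow\Diamond\Delta_1,\neg\Box\Delta_2,\Box\alpha$. ($\Diamond$K-left$^T$) $\alpha,\Gamma_1,\Delta_2\Rightarrow\Delta_1,\Gamma_2$ / $\Diamond\alpha,\Box\Gamma_1,\neg\Diamond\Gamma_2\Rightarrow\Diamond\Delta_1,\neg\Box\Delta_2$. ($\neg\Box$K-left$^T$) $\Gamma_1,\Delta_2\Rightarrow\Delta_1,\Gamma_2,\alpha$ / $\neg\Box\alpha,\Box\Gamma_1,\neg\Diamond\Gamma_2\Rightarrow\Diamond\Delta_1,\neg\Box\Delta_2$. ($\neg\Diamond$K-right$^T$) $\alpha,\Gamma_1,\Delta_2\Rightarrow\Delta_1,\Gamma_2$ / $\Box\Gamma_1,\neg\Diamond\Gamma_2\Rightarrow\Diamond\Delta_1,\neg\Box\Delta_2,\neg\Diamond\alpha$. gTK has no other rules. gTKT is gTK together with: ($\Box$left) $\alpha,\Gamma\Rightarrow\Delta$ / $\Box\alpha,\Gamma\Rightarrow\Delta$;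 ($\Diamond$right) $\Gamma\Rightarrow\Delta,\alpha$ / $\Gamma\Rightarrow\Delta,\Diamond\alpha$; ($\neg\Box$right$^t$) $\alpha,\Gamma\Rightarrow\Delta$ / $\Gamma\Rightarrow\Delta,\neg\Box\alpha$; ($\neg\Diamond$left$^t$) $\Gamma\Rightarrow\Delta,\alpha$ / $\neg\Diamond\alpha,\Gamma\Rightarrow\Delta$. HTS5. A hypersequent is an expression $\Gamma_1\Rightarrow\Delta_1\mid\cdots\mid\Gamma_n\Rightarrow\Delta_n$, regarded as a finite multiset of sequents; $H,G$ range over hypersequents (possibly empty), and $S\mid H$ denotes adding the sequent $S$ to $H$. Initial hypersequents: for every propositional variable $p$: $p\Rightarrow p$, $\neg p\Rightarrow\neg p$, $p,\neg p\Rightarrow$, $\Rightarrow p,\neg p$. Structural rules: (cut) $\Gamma\Rightarrow\Delta,\alpha\mid H$; $\alpha,\Sigma\Rightarrow\Pi\mid G$ / $\Gamma,\Sigma\Rightarrow\Delta,\Pi\mid H\mid G$. (merge) $\Gamma\Rightarrow\Delta\mid\Sigma\Rightarrow\Pi\mid H$ / $\Gamma,\Sigma\Rightarrow\Delta,\Pi\mid H$. (in-we-left) $\Gamma\Rightarrow\Delta\mid H$ / $\alpha,\Gamma\Rightarrow\Delta\mid H$. (in-we-right) $\Gamma\Rightarrow\Delta\mid H$ / $\Gamma\Rightarrow\Delta,\alpha\mid H$. (ex-we-left) $H$ / $\alpha\Rightarrow\ \mid H$. (ex-we-right) $H$ / $\Rightarrow\alpha\mid H$. Non-twist logical rules: ($\wedge$left)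 $\alpha,\beta,\Gamma\Rightarrow\Delta\mid H$ / $\alpha\wedge\beta,\Gamma\Rightarrow\Delta\mid H$. ($\wedge$right) $\Gamma\Rightarrow\Delta,\alpha\mid H$; $\Gamma\Rightarrow\Delta,\beta\mid G$ / $\Gamma\Rightarrow\Delta,\alpha\wedge\beta\mid H\mid G$. ($\vee$left) $\alpha,\Gamma\Rightarrow\Delta\mid H$; $\beta,\Gamma\Rightarrow\Delta\mid G$ / $\alpha\vee\beta,\Gamma\Rightarrow\Delta\mid H\mid G$. ($\vee$right) $\Gamma\Rightarrow\Delta,\alpha,\beta\mid H$ / $\Gamma\Rightarrow\Delta,\alpha\vee\beta\mid H$. ($\to$left) $\Gamma\Rightarrow\Delta,\alpha\mid H$; $\beta,\Gamma\Rightarrow\Delta\mid G$ / $\alpha\to\beta,\Gamma\Rightarrow\Delta\mid H\mid G$. ($\to$right) $\alpha,\Gamma\Rightarrow\Delta,\beta\mid H$ / $\Gamma\Rightarrow\Delta,\alpha\to\beta\mid H$. ($\Box$left) $\alpha,\Gamma\Rightarrow\Delta\mid H$ / $\Box\alpha\Rightarrow\ \mid\Gamma\Rightarrow\Delta\mid H$. ($\Box$right) $\Rightarrow\alpha\mid H$ / $\Rightarrow\Box\alpha\mid H$. ($\Diamond$left) $\alpha\Rightarrow\ \mid H$ / $\Diamond\alpha\Rightarrow\ \mid H$. ($\Diamond$right) $\Gamma\Rightarrow\Delta,\alpha\mid H$ / $\Gamma\Rightarrow\Delta\mid\ \Rightarrow\Diamond\alpha\mid H$. Twist rules: ($\neg\neg$left)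 $\alpha,\Gamma\Rightarrow\Delta\mid H$ / $\neg\neg\alpha,\Gamma\Rightarrow\Delta\mid H$. ($\neg\neg$right) $\Gamma\Rightarrow\Delta,\alpha\mid H$ / $\Gamma\Rightarrow\Delta,\neg\neg\alpha\mid H$. ($\neg\wedge$left) $\Gamma\Rightarrow\Delta,\alpha\mid H$; $\Gamma\Rightarrow\Delta,\beta\mid G$ / $\neg(\alpha\wedge\beta),\Gamma\Rightarrow\Delta\mid H\mid G$. ($\neg\wedge$right) $\alpha,\beta,\Gamma\Rightarrow\Delta\mid H$ / $\Gamma\Rightarrow\Delta,\neg(\alpha\wedge\beta)\mid H$. ($\neg\vee$left) $\Gamma\Rightarrow\Delta,\alpha,\beta\mid H$ / $\neg(\alpha\vee\beta),\Gamma\Rightarrow\Delta\mid H$. ($\neg\vee$right) $\alpha,\Gamma\Rightarrow\Delta\mid H$; $\beta,\Gamma\Rightarrow\Delta\mid G$ / $\Gamma\Rightarrow\Delta,\neg(\alpha\vee\beta)\mid H\mid G$. ($\neg\to$left) $\alpha,\Gamma\Rightarrow\Delta,\beta\mid H$ / $\neg(\alpha\to\beta),\Gamma\Rightarrow\Delta\mid H$. ($\neg\to$right) $\Gamma\Rightarrow\Delta,\alpha\mid H$; $\beta,\Gamma\Rightarrow\Delta\mid G$ / $\Gamma\Rightarrow\Delta,\neg(\alpha\to\beta)\mid H\mid G$. ($\neg\Box$S5-left$^h$) $\Rightarrow\alpha\mid H$ / $\neg\Box\alpha\Rightarrow\ \mid H$. ($\neg\Box$S5-right$^h$) $\alpha,\Gamma\Rightarrow\Delta\mid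 H$ / $\Gamma\Rightarrow\Delta\mid\ \Rightarrow\neg\Box\alpha\mid H$. ($\neg\Diamond$S5-left$^h$) $\Gamma\Rightarrow\Delta,\alpha\mid H$ / $\neg\Diamond\alpha\Rightarrow\ \mid\Gamma\Rightarrow\Delta\mid H$. ($\neg\Diamond$S5-right$^h$) $\alpha\Rightarrow\ \mid H$ / $\Rightarrow\neg\Diamond\alpha\mid H$. HTS5 has no other rules.
   Formalization: For HTS5 the claim is proved up to deleting empty components "⇒" from the conclusion (unchanged if there are none); literally it fails: cut on "⇒p | p⇒p" and "p⇒ | p⇒p" gives "⇒ | p⇒p | p⇒p", which has no cut-free proof. *)

theory Defs
  imports Main "HOL-Library.FSet" "HOL-Library.Multiset"
begin

datatype fm =
    Var nat
  | And fm fm  (infixr "\<^bold>\<and>" 55)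
  | Or fm fm   (infixr "\<^bold>\<or>" 54)
  | Imp fm fm  (infixr "\<^bold>\<rightarrow>" 53)
  | Neg fm     ("\<^bold>\<not> _" [60] 60)
  | Box fm     ("\<^bold>\<box> _" [60] 60)
  | Dia fm     ("\<^bold>\<diamond> _" [60] 60)

datatype sequent = Sequent "fm fset" "fm fset"  (infix "\<Rrightarrow>" 50)

type_synonym hypersequent = "sequent multiset"

abbreviation boxes :: "fm fset \<Rightarrow> fm fset"  ("\<^bold>\<box>\<^sub>s _" [90] 90)
  where "\<^bold>\<box>\<^sub>s \<Gamma> \<equiv> (\<lambda>a. \<^bold>\<box> a) |`| \<Gamma>"
abbreviation dias :: "fm fset \<Rightarrow> fm fset"  ("\<^bold>\<diamond>\<^sub>s _" [90] 90)
  where "\<^bold>\<diamond>\<^sub>s \<Gamma> \<equiv> (\<lambda>a. \<^bold>\<diamond> a) |`| \<Gamma>"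
abbreviation neg_boxes :: "fm fset \<Rightarrow> fm fset"  ("\<^bold>\<not>\<^bold>\<box>\<^sub>s _" [90] 90)
  where "\<^bold>\<not>\<^bold>\<box>\<^sub>s \<Gamma> \<equiv> (\<lambda>a. \<^bold>\<not> \<^bold>\<box> a) |`| \<Gamma>"
abbreviation neg_dias :: "fm fset \<Rightarrow> fm fset"  ("\<^bold>\<not>\<^bold>\<diamond>\<^sub>s _" [90] 90)
  where "\<^bold>\<not>\<^bold>\<diamond>\<^sub>s \<Gamma> \<equiv> (\<lambda>a. \<^bold>\<not> \<^bold>\<diamond> a) |`| \<Gamma>"

text \<open>A rule instance is a pair (premises, conclusion); initial (hyper)sequents are the instances
  without premises. A calculus is the set of its rule instances.\<close>

type_synonym 'j rules = "('j list \<times> 'j) set"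

inductive provable :: "'j rules \<Rightarrow> 'j \<Rightarrow> bool" for L :: "'j rules" where
  "(Ps, S) \<in> L \<Longrightarrow> (\<And>P. P \<in> set Ps \<Longrightarrow> provable L P) \<Longrightarrow> provable L S"

definition admissible :: "'j rules \<Rightarrow> 'j rules \<Rightarrow> bool" where
  "admissible R M \<longleftrightarrow> (\<forall>(Ps, S) \<in> R. (\<forall>P \<in> set Ps. provable M P) \<longrightarrow> provable M S)"


text \<open>In the rules below \<open>\<alpha>, \<Gamma>\<close> is \<open>finsert \<alpha> \<Gamma>\<close>, so that the principal formula of a rule may also
  belong to the context.\<close>

inductive_set gTK_cut :: "sequent rules" where
  "([\<Gamma> \<Rrightarrow> {|\<alpha>|}, finsert \<alpha> \<Gamma> \<Rrightarrow> \<Delta>], \<Gamma> \<Rrightarrow> \<Delta>) \<in> gTK_cut"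

inductive_set gTK_cutfree :: "sequent rules" where
  init_pos: "([], {|Var p|} \<Rrightarrow> {|Var p|}) \<in> gTK_cutfree"
| init_neg: "([], {|\<^bold>\<not> Var p|} \<Rrightarrow> {|\<^bold>\<not> Var p|}) \<in> gTK_cutfree"
| init_left: "([], {|\<^bold>\<not> Var p, Var p|} \<Rrightarrow> {||}) \<in> gTK_cutfree"
| init_right: "([], {||} \<Rrightarrow> {|\<^bold>\<not> Var p, Var p|}) \<in> gTK_cutfree"
| we_left: "([\<Gamma> \<Rrightarrow> \<Delta>], finsert \<alpha> \<Gamma> \<Rrightarrow> \<Delta>) \<in> gTK_cutfree"
| we_right: "([\<Gamma> \<Rrightarrow> \<Delta>], \<Gamma> \<Rrightarrow> finsert \<alpha> \<Delta>) \<in> gTK_cutfree"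
| and_left: "([finsert \<alpha> (finsert \<beta> \<Gamma>) \<Rrightarrow> \<Delta>], finsert (\<alpha> \<^bold>\<and> \<beta>) \<Gamma> \<Rrightarrow> \<Delta>) \<in> gTK_cutfree"
| and_right: "([\<Gamma> \<Rrightarrow> finsert \<alpha> \<Delta>, \<Gamma> \<Rrightarrow> finsert \<beta> \<Delta>], \<Gamma> \<Rrightarrow> finsert (\<alpha> \<^bold>\<and> \<beta>) \<Delta>) \<in> gTK_cutfree"
| or_left: "([finsert \<alpha> \<Gamma> \<Rrightarrow> \<Delta>, finsert \<beta> \<Gamma> \<Rrightarrow> \<Delta>], finsert (\<alpha> \<^bold>\<or> \<beta>) \<Gamma> \<Rrightarrow> \<Delta>) \<in> gTK_cutfree"
| or_right: "([\<Gamma> \<Rrightarrow> finsert \<alpha> (finsert \<beta> \<Delta>)], \<Gamma> \<Rrightarrow> finsert (\<alpha> \<^bold>\<or> \<beta>) \<Delta>) \<in> gTK_cutfree"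
| imp_left: "([\<Gamma> \<Rrightarrow> finsert \<alpha> \<Delta>, finsert \<beta> \<Gamma> \<Rrightarrow> \<Delta>], finsert (\<alpha> \<^bold>\<rightarrow> \<beta>) \<Gamma> \<Rrightarrow> \<Delta>) \<in> gTK_cutfree"
| imp_right: "([finsert \<alpha> \<Gamma> \<Rrightarrow> finsert \<beta> \<Delta>], \<Gamma> \<Rrightarrow> finsert (\<alpha> \<^bold>\<rightarrow> \<beta>) \<Delta>) \<in> gTK_cutfree"
| neg_neg_left: "([finsert \<alpha> \<Gamma> \<Rrightarrow> \<Delta>], finsert (\<^bold>\<not> \<^bold>\<not> \<alpha>) \<Gamma> \<Rrightarrow> \<Delta>) \<in> gTK_cutfree"
| neg_neg_right: "([\<Gamma> \<Rrightarrow> finsert \<alpha> \<Delta>], \<Gamma> \<Rrightarrow> finsert (\<^bold>\<not> \<^bold>\<not> \<alpha>) \<Delta>) \<in> gTK_cutfree"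
| neg_and_left:
    "([\<Gamma> \<Rrightarrow> finsert \<alpha> \<Delta>, \<Gamma> \<Rrightarrow> finsert \<beta> \<Delta>], finsert (\<^bold>\<not> (\<alpha> \<^bold>\<and> \<beta>)) \<Gamma> \<Rrightarrow> \<Delta>) \<in> gTK_cutfree"
| neg_and_right:
    "([finsert \<alpha> (finsert \<beta> \<Gamma>) \<Rrightarrow> \<Delta>], \<Gamma> \<Rrightarrow> finsert (\<^bold>\<not> (\<alpha> \<^bold>\<and> \<beta>)) \<Delta>) \<in> gTK_cutfree"
| neg_or_left:
    "([\<Gamma> \<Rrightarrow> finsert \<alpha> (finsert \<beta> \<Delta>)], finsert (\<^bold>\<not> (\<alpha> \<^bold>\<or> \<beta>)) \<Gamma> \<Rrightarrow> \<Delta>) \<in> gTK_cutfree"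
| neg_or_right:
    "([finsert \<alpha> \<Gamma> \<Rrightarrow> \<Delta>, finsert \<beta> \<Gamma> \<Rrightarrow> \<Delta>], \<Gamma> \<Rrightarrow> finsert (\<^bold>\<not> (\<alpha> \<^bold>\<or> \<beta>)) \<Delta>) \<in> gTK_cutfree"
| neg_imp_left:
    "([finsert \<alpha> \<Gamma> \<Rrightarrow> finsert \<beta> \<Delta>], finsert (\<^bold>\<not> (\<alpha> \<^bold>\<rightarrow> \<beta>)) \<Gamma> \<Rrightarrow> \<Delta>) \<in> gTK_cutfree"
| neg_imp_right:
    "([\<Gamma> \<Rrightarrow> finsert \<alpha> \<Delta>, finsert \<beta> \<Gamma> \<Rrightarrow> \<Delta>], \<Gamma> \<Rrightarrow> finsert (\<^bold>\<not> (\<alpha> \<^bold>\<rightarrow> \<beta>)) \<Delta>) \<in> gTK_cutfree"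
| box_K_right:
    "([\<Gamma>1 |\<union>| \<Delta>2 \<Rrightarrow> finsert \<alpha> (\<Delta>1 |\<union>| \<Gamma>2)],
      \<^bold>\<box>\<^sub>s \<Gamma>1 |\<union>| \<^bold>\<not>\<^bold>\<diamond>\<^sub>s \<Gamma>2 \<Rrightarrow> finsert (\<^bold>\<box> \<alpha>) (\<^bold>\<diamond>\<^sub>s \<Delta>1 |\<union>| \<^bold>\<not>\<^bold>\<box>\<^sub>s \<Delta>2)) \<in> gTK_cutfree"
| dia_K_left:
    "([finsert \<alpha> (\<Gamma>1 |\<union>| \<Delta>2) \<Rrightarrow> \<Delta>1 |\<union>| \<Gamma>2],
      finsert (\<^bold>\<diamond> \<alpha>) (\<^bold>\<box>\<^sub>s \<Gamma>1 |\<union>| \<^bold>\<not>\<^bold>\<diamond>\<^sub>s \<Gamma>2) \<Rrightarrow> \<^bold>\<diamond>\<^sub>s \<Delta>1 |\<union>| \<^bold>\<not>\<^bold>\<box>\<^sub>s \<Delta>2) \<in> gTK_cutfree"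
| neg_box_K_left:
    "([\<Gamma>1 |\<union>| \<Delta>2 \<Rrightarrow> finsert \<alpha> (\<Delta>1 |\<union>| \<Gamma>2)],
      finsert (\<^bold>\<not> \<^bold>\<box> \<alpha>) (\<^bold>\<box>\<^sub>s \<Gamma>1 |\<union>| \<^bold>\<not>\<^bold>\<diamond>\<^sub>s \<Gamma>2) \<Rrightarrow> \<^bold>\<diamond>\<^sub>s \<Delta>1 |\<union>| \<^bold>\<not>\<^bold>\<box>\<^sub>s \<Delta>2) \<in> gTK_cutfree"
| neg_dia_K_right:
    "([finsert \<alpha> (\<Gamma>1 |\<union>| \<Delta>2) \<Rrightarrow> \<Delta>1 |\<union>| \<Gamma>2],
      \<^bold>\<box>\<^sub>s \<Gamma>1 |\<union>| \<^bold>\<not>\<^bold>\<diamond>\<^sub>s \<Gamma>2 \<Rrightarrow> finsert (\<^bold>\<not> \<^bold>\<diamond> \<alpha>) (\<^bold>\<diamond>\<^sub>s \<Delta>1 |\<union>| \<^bold>\<not>\<^bold>\<box>\<^sub>s \<Delta>2)) \<in> gTK_cutfree"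

definition gTK :: "sequent rules" where
  "gTK = gTK_cutfree \<union> gTK_cut"

inductive_set T_rules :: "sequent rules" where
  box_left: "([finsert \<alpha> \<Gamma> \<Rrightarrow> \<Delta>], finsert (\<^bold>\<box> \<alpha>) \<Gamma> \<Rrightarrow> \<Delta>) \<in> T_rules"
| dia_right: "([\<Gamma> \<Rrightarrow> finsert \<alpha> \<Delta>], \<Gamma> \<Rrightarrow> finsert (\<^bold>\<diamond> \<alpha>) \<Delta>) \<in> T_rules"
| neg_box_right: "([finsert \<alpha> \<Gamma> \<Rrightarrow> \<Delta>], \<Gamma> \<Rrightarrow> finsert (\<^bold>\<not> \<^bold>\<box> \<alpha>) \<Delta>) \<in> T_rules"
| neg_dia_left: "([\<Gamma> \<Rrightarrow> finsert \<alpha> \<Delta>], finsert (\<^bold>\<not> \<^bold>\<diamond> \<alpha>) \<Gamma> \<Rrightarrow> \<Delta>) \<in> T_rules"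

definition gTKT_cutfree :: "sequent rules" where
  "gTKT_cutfree = gTK_cutfree \<union> T_rules"

definition gTKT :: "sequent rules" where
  "gTKT = gTKT_cutfree \<union> gTK_cut"


abbreviation bar :: "sequent \<Rightarrow> hypersequent \<Rightarrow> hypersequent"  (infixr "\<^bold>|" 45)
  where "S \<^bold>| H \<equiv> add_mset S H"

inductive_set HTS5_cut :: "hypersequent rules" where
  "([\<Gamma> \<Rrightarrow> finsert \<alpha> \<Delta> \<^bold>| H, finsert \<alpha> \<Sigma> \<Rrightarrow> \<Pi> \<^bold>| G],
    \<Gamma> |\<union>| \<Sigma> \<Rrightarrow> \<Delta> |\<union>| \<Pi> \<^bold>| H + G) \<in> HTS5_cut"

inductive_set HTS5_cutfree :: "hypersequent rules" where
  init_pos: "([], {# {|Var p|} \<Rrightarrow> {|Var p|} #}) \<in> HTS5_cutfree"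
| init_neg: "([], {# {|\<^bold>\<not> Var p|} \<Rrightarrow> {|\<^bold>\<not> Var p|} #}) \<in> HTS5_cutfree"
| init_left: "([], {# {|Var p, \<^bold>\<not> Var p|} \<Rrightarrow> {||} #}) \<in> HTS5_cutfree"
| init_right: "([], {# {||} \<Rrightarrow> {|Var p, \<^bold>\<not> Var p|} #}) \<in> HTS5_cutfree"
| merge: "([\<Gamma> \<Rrightarrow> \<Delta> \<^bold>| \<Sigma> \<Rrightarrow> \<Pi> \<^bold>| H], \<Gamma> |\<union>| \<Sigma> \<Rrightarrow> \<Delta> |\<union>| \<Pi> \<^bold>| H) \<in> HTS5_cutfree"
| in_we_left: "([\<Gamma> \<Rrightarrow> \<Delta> \<^bold>| H], finsert \<alpha> \<Gamma> \<Rrightarrow> \<Delta> \<^bold>| H) \<in> HTS5_cutfree"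
| in_we_right: "([\<Gamma> \<Rrightarrow> \<Delta> \<^bold>| H], \<Gamma> \<Rrightarrow> finsert \<alpha> \<Delta> \<^bold>| H) \<in> HTS5_cutfree"
| ex_we_left: "([H], {|\<alpha>|} \<Rrightarrow> {||} \<^bold>| H) \<in> HTS5_cutfree"
| ex_we_right: "([H], {||} \<Rrightarrow> {|\<alpha>|} \<^bold>| H) \<in> HTS5_cutfree"
| and_left:
    "([finsert \<alpha> (finsert \<beta> \<Gamma>) \<Rrightarrow> \<Delta> \<^bold>| H], finsert (\<alpha> \<^bold>\<and> \<beta>) \<Gamma> \<Rrightarrow> \<Delta> \<^bold>| H) \<in> HTS5_cutfree"
| and_right:
    "([\<Gamma> \<Rrightarrow> finsert \<alpha> \<Delta> \<^bold>| H, \<Gamma> \<Rrightarrow> finsert \<beta> \<Delta> \<^bold>| G],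
      \<Gamma> \<Rrightarrow> finsert (\<alpha> \<^bold>\<and> \<beta>) \<Delta> \<^bold>| H + G) \<in> HTS5_cutfree"
| or_left:
    "([finsert \<alpha> \<Gamma> \<Rrightarrow> \<Delta> \<^bold>| H, finsert \<beta> \<Gamma> \<Rrightarrow> \<Delta> \<^bold>| G],
      finsert (\<alpha> \<^bold>\<or> \<beta>) \<Gamma> \<Rrightarrow> \<Delta> \<^bold>| H + G) \<in> HTS5_cutfree"
| or_right:
    "([\<Gamma> \<Rrightarrow> finsert \<alpha> (finsert \<beta> \<Delta>) \<^bold>| H], \<Gamma> \<Rrightarrow> finsert (\<alpha> \<^bold>\<or> \<beta>) \<Delta> \<^bold>| H) \<in> HTS5_cutfree"
| imp_left:
    "([\<Gamma> \<Rrightarrow> finsert \<alpha> \<Delta> \<^bold>| H, finsert \<beta> \<Gamma> \<Rrightarrow> \<Delta> \<^bold>| G],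
      finsert (\<alpha> \<^bold>\<rightarrow> \<beta>) \<Gamma> \<Rrightarrow> \<Delta> \<^bold>| H + G) \<in> HTS5_cutfree"
| imp_right:
    "([finsert \<alpha> \<Gamma> \<Rrightarrow> finsert \<beta> \<Delta> \<^bold>| H], \<Gamma> \<Rrightarrow> finsert (\<alpha> \<^bold>\<rightarrow> \<beta>) \<Delta> \<^bold>| H) \<in> HTS5_cutfree"
| box_left:
    "([finsert \<alpha> \<Gamma> \<Rrightarrow> \<Delta> \<^bold>| H], {|\<^bold>\<box> \<alpha>|} \<Rrightarrow> {||} \<^bold>| \<Gamma> \<Rrightarrow> \<Delta> \<^bold>| H) \<in> HTS5_cutfree"
| box_right: "([{||} \<Rrightarrow> {|\<alpha>|} \<^bold>| H], {||} \<Rrightarrow> {|\<^bold>\<box> \<alpha>|} \<^bold>| H) \<in> HTS5_cutfree"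
| dia_left: "([{|\<alpha>|} \<Rrightarrow> {||} \<^bold>| H], {|\<^bold>\<diamond> \<alpha>|} \<Rrightarrow> {||} \<^bold>| H) \<in> HTS5_cutfree"
| dia_right:
    "([\<Gamma> \<Rrightarrow> finsert \<alpha> \<Delta> \<^bold>| H], \<Gamma> \<Rrightarrow> \<Delta> \<^bold>| {||} \<Rrightarrow> {|\<^bold>\<diamond> \<alpha>|} \<^bold>| H) \<in> HTS5_cutfree"
| neg_neg_left:
    "([finsert \<alpha> \<Gamma> \<Rrightarrow> \<Delta> \<^bold>| H], finsert (\<^bold>\<not> \<^bold>\<not> \<alpha>) \<Gamma> \<Rrightarrow> \<Delta> \<^bold>| H) \<in> HTS5_cutfree"
| neg_neg_right:
    "([\<Gamma> \<Rrightarrow> finsert \<alpha> \<Delta> \<^bold>| H], \<Gamma> \<Rrightarrow> finsert (\<^bold>\<not> \<^bold>\<not> \<alpha>) \<Delta> \<^bold>| H) \<in> HTS5_cutfree"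
| neg_and_left:
    "([\<Gamma> \<Rrightarrow> finsert \<alpha> \<Delta> \<^bold>| H, \<Gamma> \<Rrightarrow> finsert \<beta> \<Delta> \<^bold>| G],
      finsert (\<^bold>\<not> (\<alpha> \<^bold>\<and> \<beta>)) \<Gamma> \<Rrightarrow> \<Delta> \<^bold>| H + G) \<in> HTS5_cutfree"
| neg_and_right:
    "([finsert \<alpha> (finsert \<beta> \<Gamma>) \<Rrightarrow> \<Delta> \<^bold>| H],
      \<Gamma> \<Rrightarrow> finsert (\<^bold>\<not> (\<alpha> \<^bold>\<and> \<beta>)) \<Delta> \<^bold>| H) \<in> HTS5_cutfree"
| neg_or_left:
    "([\<Gamma> \<Rrightarrow> finsert \<alpha> (finsert \<beta> \<Delta>) \<^bold>| H],
      finsert (\<^bold>\<not> (\<alpha> \<^bold>\<or> \<beta>)) \<Gamma> \<Rrightarrow> \<Delta> \<^bold>| H) \<in> HTS5_cutfree"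
| neg_or_right:
    "([finsert \<alpha> \<Gamma> \<Rrightarrow> \<Delta> \<^bold>| H, finsert \<beta> \<Gamma> \<Rrightarrow> \<Delta> \<^bold>| G],
      \<Gamma> \<Rrightarrow> finsert (\<^bold>\<not> (\<alpha> \<^bold>\<or> \<beta>)) \<Delta> \<^bold>| H + G) \<in> HTS5_cutfree"
| neg_imp_left:
    "([finsert \<alpha> \<Gamma> \<Rrightarrow> finsert \<beta> \<Delta> \<^bold>| H],
      finsert (\<^bold>\<not> (\<alpha> \<^bold>\<rightarrow> \<beta>)) \<Gamma> \<Rrightarrow> \<Delta> \<^bold>| H) \<in> HTS5_cutfree"
| neg_imp_right:
    "([\<Gamma> \<Rrightarrow> finsert \<alpha> \<Delta> \<^bold>| H, finsert \<beta> \<Gamma> \<Rrightarrow> \<Delta> \<^bold>| G],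
      \<Gamma> \<Rrightarrow> finsert (\<^bold>\<not> (\<alpha> \<^bold>\<rightarrow> \<beta>)) \<Delta> \<^bold>| H + G) \<in> HTS5_cutfree"
| neg_box_left: "([{||} \<Rrightarrow> {|\<alpha>|} \<^bold>| H], {|\<^bold>\<not> \<^bold>\<box> \<alpha>|} \<Rrightarrow> {||} \<^bold>| H) \<in> HTS5_cutfree"
| neg_box_right:
    "([finsert \<alpha> \<Gamma> \<Rrightarrow> \<Delta> \<^bold>| H], \<Gamma> \<Rrightarrow> \<Delta> \<^bold>| {||} \<Rrightarrow> {|\<^bold>\<not> \<^bold>\<box> \<alpha>|} \<^bold>| H) \<in> HTS5_cutfree"
| neg_dia_left:
    "([\<Gamma> \<Rrightarrow> finsert \<alpha> \<Delta> \<^bold>| H], {|\<^bold>\<not> \<^bold>\<diamond> \<alpha>|} \<Rrightarrow> {||} \<^bold>| \<Gamma> \<Rrightarrow> \<Delta> \<^bold>| H) \<in> HTS5_cutfree"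
| neg_dia_right: "([{|\<alpha>|} \<Rrightarrow> {||} \<^bold>| H], {||} \<Rrightarrow> {|\<^bold>\<not> \<^bold>\<diamond> \<alpha>|} \<^bold>| H) \<in> HTS5_cutfree"

definition HTS5 :: "hypersequent rules" where
  "HTS5 = HTS5_cutfree \<union> HTS5_cut"


text \<open>An empty component \<open>{||} \<Rrightarrow> {||}\<close> of a hypersequent is a disjunct that is never valid. (cut) can
  introduce it anywhere, whereas in cut-free HTS5 external weakening only adds components that
  contain a formula. So (cut) is eliminable only up to deletion of empty components, as
  \<open>HTS5_cut_not_eliminable\<close> below shows. For a hypersequent without empty components
  \<open>drop_empty\<close> is the identity.\<close>

definition drop_empty :: "hypersequent \<Rightarrow> hypersequent" where
  "drop_empty H = {# S \<in># H. S \<noteq> ({||} \<Rrightarrow> {||}) #}"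

lemma drop_empty_id: "({||} \<Rrightarrow> {||}) \<notin># H \<Longrightarrow> drop_empty H = H"
  unfolding drop_empty_def by (induction H) auto

lemma HTS5_cut_not_eliminable:
  fixes p :: nat
  defines "H \<equiv> ({||} \<Rrightarrow> {||}) \<^bold>| {|Var p|} \<Rrightarrow> {|Var p|} \<^bold>| {# {|Var p|} \<Rrightarrow> {|Var p|} #}"
  shows "provable HTS5 H" and "\<not> provable HTS5_cutfree H"
proof -
  let ?I = "{# {|Var p|} \<Rrightarrow> {|Var p|} #}"
  have I: "provable HTS5 ?I"
    by (rule provable.intros[where Ps = "[]"]) (auto simp: HTS5_def intro: HTS5_cutfree.intros)
  have l: "provable HTS5 ({|Var p|} \<Rrightarrow> {||} \<^bold>| ?I)"
    by (rule provable.intros[where Ps = "[?I]"])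
      (use I in \<open>auto simp: HTS5_def intro: HTS5_cutfree.intros\<close>)
  have r: "provable HTS5 ({||} \<Rrightarrow> {|Var p|} \<^bold>| ?I)"
    by (rule provable.intros[where Ps = "[?I]"])
      (use I in \<open>auto simp: HTS5_def intro: HTS5_cutfree.intros\<close>)
  have "([{||} \<Rrightarrow> {|Var p|} \<^bold>| ?I, {|Var p|} \<Rrightarrow> {||} \<^bold>| ?I], H) \<in> HTS5"
    using HTS5_cut.intros[of "{||}" "Var p" "{||}" ?I "{||}" "{||}" ?I]
    by (simp add: HTS5_def H_def)
  then show "provable HTS5 H"
    by (rule provable.intros) (use l r in auto)
next
  let ?atomic = "\<lambda>S. case S of \<Gamma> \<Rrightarrow> \<Delta> \<Rightarrow> \<forall>a \<in> fset \<Gamma> \<union> fset \<Delta>. a \<in> range Var"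
  have inv: "\<forall>S \<in># G. ?atomic S \<Longrightarrow> ({||} \<Rrightarrow> {||}) \<notin># G" if "provable HTS5_cutfree G" for G
    using that
  proof (induction rule: provable.induct)
    case (1 Ps G)
    have IH: "\<forall>P \<in> set Ps. (\<forall>S \<in># P. ?atomic S) \<longrightarrow> ({||} \<Rrightarrow> {||}) \<notin># P"
      using 1 by blast
    from 1(1) IH 1(4) show ?case
      by (cases rule: HTS5_cutfree.cases) (simp_all add: ball_Un image_iff, auto)
  qed
  show "\<not> provable HTS5_cutfree H"
    using inv[of H] by (auto simp: H_def)
qed

end

theory Submission
  imports Defs
begin

text \<open>All three calculi are sound, with (cut), for Kripke semantics with classical negation: over all
  frames (gTK), over reflexive frames (gTKT) and over frames with universal accessibility (HTS5).
  The cut-free calculi are complete for the same semantics, whence (cut) is eliminable.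
  A countermodel of an unprovable sequent has as worlds the maximal consistent sets of signed
  formulas. Without (cut) such a set need not decide every formula, but maximality still makes it
  saturated under every rule, which is what the truth lemma uses.
  For HTS5 one first extends the components of an unprovable hypersequent to a maximal set
  \<open>\<H>\<close> of sequents from which no provable hypersequent can be drawn. Calling a sequent \<open>S\<close>
  derivable if \<open>S | H\<close> is provable for some \<open>H\<close> drawn from \<open>\<H>\<close>, all propositional rules
  become sequent rules, and the modal rules say that all maximal consistent sets see each other.\<close>

section \<open>Kripke semantics and soundness\<close>

fun sat :: "('w \<Rightarrow> nat \<Rightarrow> bool) \<Rightarrow> ('w \<Rightarrow> 'w \<Rightarrow> bool) \<Rightarrow> 'w \<Rightarrow> fm \<Rightarrow> bool" where
  "sat V R w (Var p) \<longleftrightarrow> V w p"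
| "sat V R w (a \<^bold>\<and> b) \<longleftrightarrow> sat V R w a \<and> sat V R w b"
| "sat V R w (a \<^bold>\<or> b) \<longleftrightarrow> sat V R w a \<or> sat V R w b"
| "sat V R w (a \<^bold>\<rightarrow> b) \<longleftrightarrow> (sat V R w a \<longrightarrow> sat V R w b)"
| "sat V R w (\<^bold>\<not> a) \<longleftrightarrow> \<not> sat V R w a"
| "sat V R w (\<^bold>\<box> a) \<longleftrightarrow> (\<forall>v. R w v \<longrightarrow> sat V R v a)"
| "sat V R w (\<^bold>\<diamond> a) \<longleftrightarrow> (\<exists>v. R w v \<and> sat V R v a)"

fun sat_seq :: "('w \<Rightarrow> nat \<Rightarrow> bool) \<Rightarrow> ('w \<Rightarrow> 'w \<Rightarrow> bool) \<Rightarrow> 'w \<Rightarrow> sequent \<Rightarrow> bool" where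
  "sat_seq V R w (\<Gamma> \<Rrightarrow> \<Delta>) \<longleftrightarrow> (\<forall>a \<in> fset \<Gamma>. sat V R w a) \<longrightarrow> (\<exists>b \<in> fset \<Delta>. sat V R w b)"

text \<open>The premises are assumed at every world, not only at \<open>w\<close>, because the four
  K rules evaluate their premise at a successor of \<open>w\<close>. Cut and the T rules are
  local.\<close>

lemma gTK_cutfree_sound:
  assumes "(Ps, S) \<in> gTK_cutfree" and "\<forall>P \<in> set Ps. \<forall>w. sat_seq V R w P"
  shows "sat_seq V R w S"
  using assms
proof (cases rule: gTK_cutfree.cases)
  case (box_K_right \<Gamma>1 \<Delta>2 \<alpha> \<Delta>1 \<Gamma>2)
  have "sat_seq V R v (\<Gamma>1 |\<union>| \<Delta>2 \<Rrightarrow> finsert \<alpha> (\<Delta>1 |\<union>| \<Gamma>2))" for v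
    using assms(2) box_K_right by simp
  then show ?thesis unfolding box_K_right by (simp add: ball_Un bex_Un) blast
next
  case (dia_K_left \<alpha> \<Gamma>1 \<Delta>2 \<Delta>1 \<Gamma>2)
  have "sat_seq V R v (finsert \<alpha> (\<Gamma>1 |\<union>| \<Delta>2) \<Rrightarrow> \<Delta>1 |\<union>| \<Gamma>2)" for v
    using assms(2) dia_K_left by simp
  then show ?thesis unfolding dia_K_left by (simp add: ball_Un bex_Un) blast
next
  case (neg_box_K_left \<Gamma>1 \<Delta>2 \<alpha> \<Delta>1 \<Gamma>2)
  have "sat_seq V R v (\<Gamma>1 |\<union>| \<Delta>2 \<Rrightarrow> finsert \<alpha> (\<Delta>1 |\<union>| \<Gamma>2))" for v
    using assms(2) neg_box_K_left by simp
  then show ?thesis unfolding neg_box_K_left by (simp add: ball_Un bex_Un) blast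
next
  case (neg_dia_K_right \<alpha> \<Gamma>1 \<Delta>2 \<Delta>1 \<Gamma>2)
  have "sat_seq V R v (finsert \<alpha> (\<Gamma>1 |\<union>| \<Delta>2) \<Rrightarrow> \<Delta>1 |\<union>| \<Gamma>2)" for v
    using assms(2) neg_dia_K_right by simp
  then show ?thesis unfolding neg_dia_K_right by (simp add: ball_Un bex_Un) blast
qed (simp_all, blast+)

lemma gTK_cut_sound:
  assumes "(Ps, S) \<in> gTK_cut" and "\<forall>P \<in> set Ps. sat_seq V R w P"
  shows "sat_seq V R w S"
  using assms by (cases rule: gTK_cut.cases) auto

lemma T_rules_sound:
  assumes "(Ps, S) \<in> T_rules" and "\<forall>P \<in> set Ps. sat_seq V R w P" and "R w w"
  shows "sat_seq V R w S"
  using assms by (cases rule: T_rules.cases) auto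

lemma gTK_sound: "provable gTK S \<Longrightarrow> sat_seq V R w S"
proof (induction arbitrary: w rule: provable.induct)
  case (1 Ps S)
  then show ?case unfolding gTK_def
    using gTK_cutfree_sound[of Ps S V R w] gTK_cut_sound[of Ps S V R w] by blast
qed

lemma gTKT_sound: "provable gTKT S \<Longrightarrow> (\<And>w. R w w) \<Longrightarrow> sat_seq V R w S"
proof (induction arbitrary: w rule: provable.induct)
  case (1 Ps S)
  then show ?case unfolding gTKT_def gTKT_cutfree_def
    using gTK_cutfree_sound[of Ps S V R w] gTK_cut_sound[of Ps S V R w] T_rules_sound[of Ps S V R w]
    by blast
qed

text \<open>The bar is a disjunction of global statements: a single component must hold throughout
  \<open>W\<close>. The worlds form a set rather than a whole type, so that the maximal consistent
  sets can later be the universal frame.\<close>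

definition sat_hyp :: "('w \<Rightarrow> nat \<Rightarrow> bool) \<Rightarrow> 'w set \<Rightarrow> hypersequent \<Rightarrow> bool" where
  "sat_hyp V W H \<longleftrightarrow> (\<exists>S \<in># H. \<forall>w \<in> W. sat_seq V (\<lambda>_ v. v \<in> W) w S)"

lemma sat_hyp_add [simp]:
  "sat_hyp V W (add_mset S H) \<longleftrightarrow> (\<forall>w \<in> W. sat_seq V (\<lambda>_ v. v \<in> W) w S) \<or> sat_hyp V W H"
  and sat_hyp_empty [simp]: "\<not> sat_hyp V W {#}"
  and sat_hyp_union [simp]: "sat_hyp V W (H + G) \<longleftrightarrow> sat_hyp V W H \<or> sat_hyp V W G"
  unfolding sat_hyp_def by auto

text \<open>A modal formula has the same truth value at all worlds of \<open>W\<close>. Hence, when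
  a rule splits a component, either the new modal component holds throughout \<open>W\<close>, or
  the formula under the modality can be discharged at every world.\<close>

lemma HTS5_cutfree_sound:
  assumes "(Ps, H) \<in> HTS5_cutfree" and "\<forall>P \<in> set Ps. sat_hyp V W P"
  shows "sat_hyp V W H"
  using assms by (cases rule: HTS5_cutfree.cases) (auto simp add: ball_Un bex_Un)

lemma HTS5_cut_sound:
  assumes "(Ps, H) \<in> HTS5_cut" and "\<forall>P \<in> set Ps. sat_hyp V W P"
  shows "sat_hyp V W H"
  using assms by (cases rule: HTS5_cut.cases) (simp add: ball_Un bex_Un, blast)

lemma HTS5_sound: "provable HTS5 H \<Longrightarrow> sat_hyp V W H"
proof (induction rule: provable.induct)
  case (1 Ps H)
  then show ?case unfolding HTS5_def
    using HTS5_cutfree_sound[of Ps H V W] HTS5_cut_sound[of Ps H V W] by blast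
qed

section \<open>Maximal consistent sets of signed formulas\<close>

text \<open>Zorn's lemma for a property of finite character: a finite subset of the union of a chain
  already lies in one member. It serves twice, for sets of signed formulas and for sets of
  sequents.\<close>

lemma finite_character_maximal:
  assumes fin: "\<And>A. (\<And>F. finite F \<Longrightarrow> F \<subseteq> A \<Longrightarrow> Q F) \<Longrightarrow> Q A"
    and mono: "\<And>A B. Q B \<Longrightarrow> A \<subseteq> B \<Longrightarrow> Q A"
    and "Q A"
  obtains M where "A \<subseteq> M" and "Q M" and "\<And>B. Q B \<Longrightarrow> M \<subseteq> B \<Longrightarrow> B = M"
proof -
  let ?A = "{B. A \<subseteq> B \<and> Q B}"
  have "\<exists>M \<in> ?A. \<forall>X \<in> ?A. M \<subseteq> X \<longrightarrow> X = M"
  proof (rule subset_Zorn_nonempty)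
    show "?A \<noteq> {}" using \<open>Q A\<close> by auto
    fix C assume C: "C \<noteq> {}" "subset.chain ?A C"
    have "Q (\<Union>C)"
    proof (rule fin)
      fix F assume F: "finite F" "F \<subseteq> \<Union>C"
      obtain B where "B \<in> C" "F \<subseteq> B"
        by (rule finite_subset_Union_chain[OF F C])
      moreover have "Q B"
        using C(2) \<open>B \<in> C\<close> unfolding subset.chain_def by blast
      ultimately show "Q F" using mono by metis
    qed
    moreover have "A \<subseteq> \<Union>C"
      using C unfolding subset.chain_def by blast
    ultimately show "\<Union>C \<in> ?A" by blast
  qed
  then obtain M where M: "A \<subseteq> M" "Q M" and max: "\<forall>X \<in> ?A. M \<subseteq> X \<longrightarrow> X = M" by auto
  have "B = M" if "Q B" "M \<subseteq> B" for B
  proof -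
    have "B \<in> ?A" using that M(1) by simp
    with max that(2) show ?thesis by simp
  qed
  with M show thesis by (rule that)
qed

text \<open>A signed set is a possibly infinite sequent, with \<open>True\<close> marking the left
  side and \<open>False\<close> the right side.\<close>

type_synonym signed_set = "(bool \<times> fm) set"

abbreviation pos :: "signed_set \<Rightarrow> fm set" where "pos w \<equiv> {a. (True, a) \<in> w}"
abbreviation neg :: "signed_set \<Rightarrow> fm set" where "neg w \<equiv> {a. (False, a) \<in> w}"

text \<open>The propositional part common to the three calculi. \<open>D\<close> is an arbitrary
  relation, so that derivability relative to a set of side components is an instance too.\<close>

locale twist_derivability =
  fixes D :: "fm fset \<Rightarrow> fm fset \<Rightarrow> bool"
  assumes init_pos: "D {|Var p|} {|Var p|}"
    and init_neg: "D {|\<^bold>\<not> Var p|} {|\<^bold>\<not> Var p|}"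
    and init_left: "D {|\<^bold>\<not> Var p, Var p|} {||}"
    and init_right: "D {||} {|\<^bold>\<not> Var p, Var p|}"
    and we_left: "D \<Gamma> \<Delta> \<Longrightarrow> D (finsert a \<Gamma>) \<Delta>"
    and we_right: "D \<Gamma> \<Delta> \<Longrightarrow> D \<Gamma> (finsert a \<Delta>)"
    and and_left: "D (finsert a (finsert b \<Gamma>)) \<Delta> \<Longrightarrow> D (finsert (a \<^bold>\<and> b) \<Gamma>) \<Delta>"
    and and_right: "D \<Gamma> (finsert a \<Delta>) \<Longrightarrow> D \<Gamma> (finsert b \<Delta>) \<Longrightarrow> D \<Gamma> (finsert (a \<^bold>\<and> b) \<Delta>)"
    and or_left: "D (finsert a \<Gamma>) \<Delta> \<Longrightarrow> D (finsert b \<Gamma>) \<Delta> \<Longrightarrow> D (finsert (a \<^bold>\<or> b) \<Gamma>) \<Delta>"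
    and or_right: "D \<Gamma> (finsert a (finsert b \<Delta>)) \<Longrightarrow> D \<Gamma> (finsert (a \<^bold>\<or> b) \<Delta>)"
    and imp_left: "D \<Gamma> (finsert a \<Delta>) \<Longrightarrow> D (finsert b \<Gamma>) \<Delta> \<Longrightarrow> D (finsert (a \<^bold>\<rightarrow> b) \<Gamma>) \<Delta>"
    and imp_right: "D (finsert a \<Gamma>) (finsert b \<Delta>) \<Longrightarrow> D \<Gamma> (finsert (a \<^bold>\<rightarrow> b) \<Delta>)"
    and neg_neg_left: "D (finsert a \<Gamma>) \<Delta> \<Longrightarrow> D (finsert (\<^bold>\<not> \<^bold>\<not> a) \<Gamma>) \<Delta>"
    and neg_neg_right: "D \<Gamma> (finsert a \<Delta>) \<Longrightarrow> D \<Gamma> (finsert (\<^bold>\<not> \<^bold>\<not> a) \<Delta>)"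
    and neg_and_left:
      "D \<Gamma> (finsert a \<Delta>) \<Longrightarrow> D \<Gamma> (finsert b \<Delta>) \<Longrightarrow> D (finsert (\<^bold>\<not> (a \<^bold>\<and> b)) \<Gamma>) \<Delta>"
    and neg_and_right: "D (finsert a (finsert b \<Gamma>)) \<Delta> \<Longrightarrow> D \<Gamma> (finsert (\<^bold>\<not> (a \<^bold>\<and> b)) \<Delta>)"
    and neg_or_left: "D \<Gamma> (finsert a (finsert b \<Delta>)) \<Longrightarrow> D (finsert (\<^bold>\<not> (a \<^bold>\<or> b)) \<Gamma>) \<Delta>"
    and neg_or_right:
      "D (finsert a \<Gamma>) \<Delta> \<Longrightarrow> D (finsert b \<Gamma>) \<Delta> \<Longrightarrow> D \<Gamma> (finsert (\<^bold>\<not> (a \<^bold>\<or> b)) \<Delta>)"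
    and neg_imp_left: "D (finsert a \<Gamma>) (finsert b \<Delta>) \<Longrightarrow> D (finsert (\<^bold>\<not> (a \<^bold>\<rightarrow> b)) \<Gamma>) \<Delta>"
    and neg_imp_right:
      "D \<Gamma> (finsert a \<Delta>) \<Longrightarrow> D (finsert b \<Gamma>) \<Delta> \<Longrightarrow> D \<Gamma> (finsert (\<^bold>\<not> (a \<^bold>\<rightarrow> b)) \<Delta>)"
begin

lemma we_left_union: "D \<Gamma> \<Delta> \<Longrightarrow> D (\<Sigma> |\<union>| \<Gamma>) \<Delta>"
  by (induction \<Sigma>) (auto intro: we_left)

lemma we_right_union: "D \<Gamma> \<Delta> \<Longrightarrow> D \<Gamma> (\<Sigma> |\<union>| \<Delta>)"
  by (induction \<Sigma>) (auto intro: we_right)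

lemma weaken:
  assumes "D \<Gamma> \<Delta>" and "\<Gamma> |\<subseteq>| \<Gamma>'" and "\<Delta> |\<subseteq>| \<Delta>'"
  shows "D \<Gamma>' \<Delta>'"
  using we_left_union[OF we_right_union[OF assms(1), of \<Delta>'], of \<Gamma>'] assms(2,3)
  by (simp add: sup.absorb1)

section \<open>Consistency, maximality and extension to maximal sets\<close>

definition consistent :: "signed_set \<Rightarrow> bool" where
  "consistent w \<longleftrightarrow> (\<forall>\<Gamma> \<Delta>. fset \<Gamma> \<subseteq> pos w \<longrightarrow> fset \<Delta> \<subseteq> neg w \<longrightarrow> \<not> D \<Gamma> \<Delta>)"

definition maximal :: "signed_set \<Rightarrow> bool" where
  "maximal w \<longleftrightarrow> consistent w \<and> (\<forall>v. consistent v \<longrightarrow> w \<subseteq> v \<longrightarrow> v = w)"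

lemma consistentD: "consistent w \<Longrightarrow> fset \<Gamma> \<subseteq> pos w \<Longrightarrow> fset \<Delta> \<subseteq> neg w \<Longrightarrow> \<not> D \<Gamma> \<Delta>"
  unfolding consistent_def by blast

lemma maximalD: "maximal w \<Longrightarrow> fset \<Gamma> \<subseteq> pos w \<Longrightarrow> fset \<Delta> \<subseteq> neg w \<Longrightarrow> \<not> D \<Gamma> \<Delta>"
  unfolding maximal_def by (metis consistentD)

lemma extend_to_maximal:
  assumes "consistent v"
  obtains w where "v \<subseteq> w" and "maximal w"
proof (rule finite_character_maximal[of consistent v])
  show "consistent v" by fact
  show "consistent A" if "consistent B" "A \<subseteq> B" for A B
    unfolding consistent_def
  proof (intro allI impI)
    fix \<Gamma> \<Delta> assume "fset \<Gamma> \<subseteq> pos A" "fset \<Delta> \<subseteq> neg A"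
    with \<open>A \<subseteq> B\<close> show "\<not> D \<Gamma> \<Delta>" by (intro consistentD[OF \<open>consistent B\<close>]) auto
  qed
  show "consistent A" if *: "\<And>F. finite F \<Longrightarrow> F \<subseteq> A \<Longrightarrow> consistent F" for A
    unfolding consistent_def
  proof (intro allI impI)
    fix \<Gamma> \<Delta> assume "fset \<Gamma> \<subseteq> pos A" "fset \<Delta> \<subseteq> neg A"
    \<comment> \<open>A sequent uses only finitely many signed formulas, and the finite set of these
      is consistent by \<open>*\<close>.\<close>
    then have "consistent (Pair True ` fset \<Gamma> \<union> Pair False ` fset \<Delta>)"
      by (intro *) auto
    then show "\<not> D \<Gamma> \<Delta>" by (rule consistentD) auto
  qed
qed (use that in \<open>auto simp: maximal_def\<close>)

text \<open>Whatever is drawn from this set is a subsequent of the given one, to which weakening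
  would carry its derivability.\<close>

lemma consistent_sequent:
  assumes "\<not> D \<Gamma> \<Delta>"
  shows "consistent (Pair True ` fset \<Gamma> \<union> Pair False ` fset \<Delta>)"
  unfolding consistent_def
proof (intro allI impI notI)
  fix \<Gamma>' \<Delta>'
  assume "fset \<Gamma>' \<subseteq> pos (Pair True ` fset \<Gamma> \<union> Pair False ` fset \<Delta>)"
    and "fset \<Delta>' \<subseteq> neg (Pair True ` fset \<Gamma> \<union> Pair False ` fset \<Delta>)" and D: "D \<Gamma>' \<Delta>'"
  then have "\<Gamma>' |\<subseteq>| \<Gamma>" and "\<Delta>' |\<subseteq>| \<Delta>" by auto
  with D assms show False using weaken by blast
qed

lemma maximal_of_sequent:
  assumes "\<not> D \<Gamma> \<Delta>"
  obtains w where "maximal w" and "fset \<Gamma> \<subseteq> pos w" and "fset \<Delta> \<subseteq> neg w"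
proof -
  obtain w where "Pair True ` fset \<Gamma> \<union> Pair False ` fset \<Delta> \<subseteq> w" "maximal w"
    by (rule extend_to_maximal[OF consistent_sequent[OF assms]])
  then show thesis using that[of w] by auto
qed

text \<open>Adding \<Gamma> on the left and \<Delta> on the right makes \<open>w\<close>
  inconsistent. The added formulas are kept apart from the context, ready to be the active formulas
  of a rule.\<close>

definition closes :: "signed_set \<Rightarrow> fm fset \<Rightarrow> fm fset \<Rightarrow> bool" where
  "closes w \<Gamma> \<Delta> \<longleftrightarrow>
    (\<exists>\<Gamma>0 \<Delta>0. fset \<Gamma>0 \<subseteq> pos w \<and> fset \<Delta>0 \<subseteq> neg w \<and> D (\<Gamma> |\<union>| \<Gamma>0) (\<Delta> |\<union>| \<Delta>0))"

lemma closes_mono: "closes w \<Gamma> \<Delta> \<Longrightarrow> \<Gamma> |\<subseteq>| \<Gamma>' \<Longrightarrow> \<Delta> |\<subseteq>| \<Delta>' \<Longrightarrow> closes w \<Gamma>' \<Delta>'"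
  unfolding closes_def using weaken by (meson order_refl sup.mono)

text \<open>By maximality, adding \<open>a\<close> destroys consistency. Without cut, absence from
  \<open>pos w\<close> does not yield membership in \<open>neg w\<close>; this inconsistency is used
  in its place.\<close>

lemma closes_pos:
  assumes "maximal w" and "a \<notin> pos w"
  shows "closes w {|a|} {||}"
proof -
  have "\<not> consistent (insert (True, a) w)"
    using assms unfolding maximal_def by (metis insertI1 mem_Collect_eq subset_insertI)
  then obtain \<Gamma> \<Delta> where *: "fset \<Gamma> \<subseteq> insert a (pos w)" "fset \<Delta> \<subseteq> neg w" "D \<Gamma> \<Delta>"
    unfolding consistent_def by auto
  \<comment> \<open>Weakening covers the case that \<open>a\<close> does not occur in
    \<Gamma>.\<close>
  then have "D ({|a|} |\<union>| (\<Gamma> |-| {|a|})) ({||} |\<union>| \<Delta>)"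
    by (intro weaken[OF *(3)]) auto
  moreover have "fset (\<Gamma> |-| {|a|}) \<subseteq> pos w" using * by auto
  ultimately show ?thesis unfolding closes_def using *(2) by metis
qed

lemma closes_neg:
  assumes "maximal w" and "a \<notin> neg w"
  shows "closes w {||} {|a|}"
proof -
  have "\<not> consistent (insert (False, a) w)"
    using assms unfolding maximal_def by (metis insertI1 mem_Collect_eq subset_insertI)
  then obtain \<Gamma> \<Delta> where *: "fset \<Gamma> \<subseteq> pos w" "fset \<Delta> \<subseteq> insert a (neg w)" "D \<Gamma> \<Delta>"
    unfolding consistent_def by auto
  then have "D ({||} |\<union>| \<Gamma>) ({|a|} |\<union>| (\<Delta> |-| {|a|}))"
    by (intro weaken[OF *(3)]) auto
  moreover have "fset (\<Delta> |-| {|a|}) \<subseteq> neg w" using * by auto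
  ultimately show ?thesis unfolding closes_def using *(1) by metis
qed

text \<open>Two-premise rules share their context, so the two witnessing contexts are joined and
  each derivation is weakened to the union.\<close>

lemma closes_common_context:
  assumes "closes w \<Gamma>1 \<Delta>1" and "closes w \<Gamma>2 \<Delta>2"
  obtains \<Gamma> \<Delta> where "fset \<Gamma> \<subseteq> pos w" and "fset \<Delta> \<subseteq> neg w"
    and "D (\<Gamma>1 |\<union>| \<Gamma>) (\<Delta>1 |\<union>| \<Delta>)" and "D (\<Gamma>2 |\<union>| \<Gamma>) (\<Delta>2 |\<union>| \<Delta>)"
proof -
  obtain \<Gamma> \<Delta> \<Gamma>' \<Delta>' where *: "fset \<Gamma> \<subseteq> pos w" "fset \<Delta> \<subseteq> neg w" "fset \<Gamma>' \<subseteq> pos w" "fset \<Delta>' \<subseteq> neg w"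
    and D: "D (\<Gamma>1 |\<union>| \<Gamma>) (\<Delta>1 |\<union>| \<Delta>)" "D (\<Gamma>2 |\<union>| \<Gamma>') (\<Delta>2 |\<union>| \<Delta>')"
    using assms unfolding closes_def by metis
  show thesis
  proof (rule that)
    show "fset (\<Gamma> |\<union>| \<Gamma>') \<subseteq> pos w" "fset (\<Delta> |\<union>| \<Delta>') \<subseteq> neg w" using * by auto
    show "D (\<Gamma>1 |\<union>| (\<Gamma> |\<union>| \<Gamma>')) (\<Delta>1 |\<union>| (\<Delta> |\<union>| \<Delta>'))" by (rule weaken[OF D(1)]) auto
    show "D (\<Gamma>2 |\<union>| (\<Gamma> |\<union>| \<Gamma>')) (\<Delta>2 |\<union>| (\<Delta> |\<union>| \<Delta>'))" by (rule weaken[OF D(2)]) auto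
  qed
qed

text \<open>If the active formulas of a premise closed \<open>w\<close>, the rule would derive a
  sequent drawn from \<open>w\<close> itself. Together with \<open>closes_pos\<close> and
  \<open>closes_neg\<close> this turns each rule into a saturation property. The next three lemmas
  treat right rules and two premises.\<close>

lemma not_closes_pos:
  assumes "maximal w" and "c \<in> pos w" and "closes w \<Gamma> \<Delta>"
    and rule: "\<And>\<Gamma>0 \<Delta>0. D (\<Gamma> |\<union>| \<Gamma>0) (\<Delta> |\<union>| \<Delta>0) \<Longrightarrow> D (finsert c \<Gamma>0) \<Delta>0"
  shows False
proof -
  obtain \<Gamma>0 \<Delta>0 where "fset \<Gamma>0 \<subseteq> pos w" "fset \<Delta>0 \<subseteq> neg w" "D (finsert c \<Gamma>0) \<Delta>0"
    using assms(3) rule unfolding closes_def by metis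
  then show False using maximalD[OF assms(1), of "finsert c \<Gamma>0" \<Delta>0] assms(2) by simp
qed

lemma not_closes_neg:
  assumes "maximal w" and "c \<in> neg w" and "closes w \<Gamma> \<Delta>"
    and rule: "\<And>\<Gamma>0 \<Delta>0. D (\<Gamma> |\<union>| \<Gamma>0) (\<Delta> |\<union>| \<Delta>0) \<Longrightarrow> D \<Gamma>0 (finsert c \<Delta>0)"
  shows False
proof -
  obtain \<Gamma>0 \<Delta>0 where "fset \<Gamma>0 \<subseteq> pos w" "fset \<Delta>0 \<subseteq> neg w" "D \<Gamma>0 (finsert c \<Delta>0)"
    using assms(3) rule unfolding closes_def by metis
  then show False using maximalD[OF assms(1), of \<Gamma>0 "finsert c \<Delta>0"] assms(2) by simp
qed

lemma not_closes2_pos: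
  assumes "maximal w" and "c \<in> pos w" and "closes w \<Gamma>1 \<Delta>1" and "closes w \<Gamma>2 \<Delta>2"
    and rule: "\<And>\<Gamma>0 \<Delta>0. D (\<Gamma>1 |\<union>| \<Gamma>0) (\<Delta>1 |\<union>| \<Delta>0) \<Longrightarrow> D (\<Gamma>2 |\<union>| \<Gamma>0) (\<Delta>2 |\<union>| \<Delta>0) \<Longrightarrow>
      D (finsert c \<Gamma>0) \<Delta>0"
  shows False
proof -
  obtain \<Gamma>0 \<Delta>0 where "fset \<Gamma>0 \<subseteq> pos w" "fset \<Delta>0 \<subseteq> neg w" "D (finsert c \<Gamma>0) \<Delta>0"
    using closes_common_context[OF assms(3,4)] rule by metis
  then show False using maximalD[OF assms(1), of "finsert c \<Gamma>0" \<Delta>0] assms(2) by simp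
qed

lemma not_closes2_neg:
  assumes "maximal w" and "c \<in> neg w" and "closes w \<Gamma>1 \<Delta>1" and "closes w \<Gamma>2 \<Delta>2"
    and rule: "\<And>\<Gamma>0 \<Delta>0. D (\<Gamma>1 |\<union>| \<Gamma>0) (\<Delta>1 |\<union>| \<Delta>0) \<Longrightarrow> D (\<Gamma>2 |\<union>| \<Gamma>0) (\<Delta>2 |\<union>| \<Delta>0) \<Longrightarrow>
      D \<Gamma>0 (finsert c \<Delta>0)"
  shows False
proof -
  obtain \<Gamma>0 \<Delta>0 where "fset \<Gamma>0 \<subseteq> pos w" "fset \<Delta>0 \<subseteq> neg w" "D \<Gamma>0 (finsert c \<Delta>0)"
    using closes_common_context[OF assms(3,4)] rule by metis
  then show False using maximalD[OF assms(1), of \<Gamma>0 "finsert c \<Delta>0"] assms(2) by simp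
qed

text \<open>For rules with two active formulas in one premise, the absence of either formula
  suffices to close \<open>w\<close>, so saturation yields both.\<close>

lemma closes_pos2:
  "maximal w \<Longrightarrow> a \<notin> pos w \<or> b \<notin> pos w \<Longrightarrow> closes w {|a, b|} {||}"
  using closes_pos[of w a] closes_pos[of w b] closes_mono[of w _ "{||}" "{|a, b|}" "{||}"]
  by auto

lemma closes_neg2:
  "maximal w \<Longrightarrow> a \<notin> neg w \<or> b \<notin> neg w \<Longrightarrow> closes w {||} {|a, b|}"
  using closes_neg[of w a] closes_neg[of w b] closes_mono[of w "{||}" _ "{||}" "{|a, b|}"]
  by auto

lemma closes_pos_neg:
  "maximal w \<Longrightarrow> a \<notin> pos w \<or> b \<notin> neg w \<Longrightarrow> closes w {|a|} {|b|}"
  using closes_pos[of w a] closes_neg[of w b] closes_mono[of w _ _ "{|a|}" "{|b|}"]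
  by auto

section \<open>Saturation of a maximal set\<close>

context
  fixes w assumes w: "maximal w"
begin

text \<open>One-premise rules yield a conjunction, two-premise rules a disjunction. The twist rules
  move the subformulas of a negation to the other side, which flips their sign.\<close>

lemma saturated_and:
  shows "a \<^bold>\<and> b \<in> pos w \<Longrightarrow> a \<in> pos w \<and> b \<in> pos w"
    and "a \<^bold>\<and> b \<in> neg w \<Longrightarrow> a \<in> neg w \<or> b \<in> neg w"
    and "\<^bold>\<not> (a \<^bold>\<and> b) \<in> pos w \<Longrightarrow> a \<in> neg w \<or> b \<in> neg w"
    and "\<^bold>\<not> (a \<^bold>\<and> b) \<in> neg w \<Longrightarrow> a \<in> pos w \<and> b \<in> pos w"
  using not_closes_pos[OF w _ closes_pos2[OF w], of "a \<^bold>\<and> b" a b]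
    not_closes2_neg[OF w _ closes_neg[OF w] closes_neg[OF w], of "a \<^bold>\<and> b" a b]
    not_closes2_pos[OF w _ closes_neg[OF w] closes_neg[OF w], of "\<^bold>\<not> (a \<^bold>\<and> b)" a b]
    not_closes_neg[OF w _ closes_pos2[OF w], of "\<^bold>\<not> (a \<^bold>\<and> b)" a b]
    and_left and_right neg_and_left neg_and_right
  by auto

lemma saturated_or:
  shows "a \<^bold>\<or> b \<in> pos w \<Longrightarrow> a \<in> pos w \<or> b \<in> pos w"
    and "a \<^bold>\<or> b \<in> neg w \<Longrightarrow> a \<in> neg w \<and> b \<in> neg w"
    and "\<^bold>\<not> (a \<^bold>\<or> b) \<in> pos w \<Longrightarrow> a \<in> neg w \<and> b \<in> neg w"
    and "\<^bold>\<not> (a \<^bold>\<or> b) \<in> neg w \<Longrightarrow> a \<in> pos w \<or> b \<in> pos w"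
  using not_closes2_pos[OF w _ closes_pos[OF w] closes_pos[OF w], of "a \<^bold>\<or> b" a b]
    not_closes_neg[OF w _ closes_neg2[OF w], of "a \<^bold>\<or> b" a b]
    not_closes_pos[OF w _ closes_neg2[OF w], of "\<^bold>\<not> (a \<^bold>\<or> b)" a b]
    not_closes2_neg[OF w _ closes_pos[OF w] closes_pos[OF w], of "\<^bold>\<not> (a \<^bold>\<or> b)" a b]
    or_left or_right neg_or_left neg_or_right
  by auto

lemma saturated_imp:
  shows "a \<^bold>\<rightarrow> b \<in> pos w \<Longrightarrow> a \<in> neg w \<or> b \<in> pos w"
    and "a \<^bold>\<rightarrow> b \<in> neg w \<Longrightarrow> a \<in> pos w \<and> b \<in> neg w"
    and "\<^bold>\<not> (a \<^bold>\<rightarrow> b) \<in> pos w \<Longrightarrow> a \<in> pos w \<and> b \<in> neg w"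
    and "\<^bold>\<not> (a \<^bold>\<rightarrow> b) \<in> neg w \<Longrightarrow> a \<in> neg w \<or> b \<in> pos w"
  using not_closes2_pos[OF w _ closes_neg[OF w] closes_pos[OF w], of "a \<^bold>\<rightarrow> b" a b]
    not_closes_neg[OF w _ closes_pos_neg[OF w], of "a \<^bold>\<rightarrow> b" a b]
    not_closes_pos[OF w _ closes_pos_neg[OF w], of "\<^bold>\<not> (a \<^bold>\<rightarrow> b)" a b]
    not_closes2_neg[OF w _ closes_neg[OF w] closes_pos[OF w], of "\<^bold>\<not> (a \<^bold>\<rightarrow> b)" a b]
    imp_left imp_right neg_imp_left neg_imp_right
  by auto

lemma saturated_neg_neg:
  shows "\<^bold>\<not> \<^bold>\<not> a \<in> pos w \<Longrightarrow> a \<in> pos w" and "\<^bold>\<not> \<^bold>\<not> a \<in> neg w \<Longrightarrow> a \<in> neg w"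
  using not_closes_pos[OF w _ closes_pos[OF w], of "\<^bold>\<not> \<^bold>\<not> a" a]
    not_closes_neg[OF w _ closes_neg[OF w], of "\<^bold>\<not> \<^bold>\<not> a" a] neg_neg_left neg_neg_right
  by auto

text \<open>The four initial sequents exclude exactly the pairs of signed literals that place
  contradictory demands on the value of \<open>p\<close>.\<close>

lemma saturated_var:
  shows "\<not> (Var p \<in> pos w \<and> Var p \<in> neg w)"
    and "\<not> (\<^bold>\<not> Var p \<in> pos w \<and> \<^bold>\<not> Var p \<in> neg w)"
    and "\<not> (\<^bold>\<not> Var p \<in> pos w \<and> Var p \<in> pos w)"
    and "\<not> (\<^bold>\<not> Var p \<in> neg w \<and> Var p \<in> neg w)"
  using maximalD[OF w, of "{|Var p|}" "{|Var p|}"] init_pos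
    maximalD[OF w, of "{|\<^bold>\<not> Var p|}" "{|\<^bold>\<not> Var p|}"] init_neg
    maximalD[OF w, of "{|\<^bold>\<not> Var p, Var p|}" "{||}"] init_left
    maximalD[OF w, of "{||}" "{|\<^bold>\<not> Var p, Var p|}"] init_right
  by auto

end

end

section \<open>The truth lemma\<close>

text \<open>A maximal set may contain neither sign of \<open>Var p\<close> and yet refute \<open>\<^bold>\<not> Var p\<close>; the valuation
  must then make \<open>p\<close> true.\<close>

definition canonical_val :: "signed_set \<Rightarrow> nat \<Rightarrow> bool" where
  "canonical_val w p \<longleftrightarrow> Var p \<in> pos w \<or> \<^bold>\<not> Var p \<in> neg w"

text \<open>Leaving \<open>R\<close> open covers both the canonical frame of gTK and gTKT and the
  universal frame of HTS5. \<open>maximal_R\<close> keeps successors within reach of the truth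
  lemma.\<close>

locale canonical_model = twist_derivability +
  fixes R :: "signed_set \<Rightarrow> signed_set \<Rightarrow> bool"
  assumes maximal_R: "maximal w \<Longrightarrow> R w v \<Longrightarrow> maximal v"
    and box_pos: "maximal w \<Longrightarrow> \<^bold>\<box> a \<in> pos w \<Longrightarrow> R w v \<Longrightarrow> a \<in> pos v"
    and box_neg: "maximal w \<Longrightarrow> \<^bold>\<box> a \<in> neg w \<Longrightarrow> \<exists>v. R w v \<and> a \<in> neg v"
    and dia_pos: "maximal w \<Longrightarrow> \<^bold>\<diamond> a \<in> pos w \<Longrightarrow> \<exists>v. R w v \<and> a \<in> pos v"
    and dia_neg: "maximal w \<Longrightarrow> \<^bold>\<diamond> a \<in> neg w \<Longrightarrow> R w v \<Longrightarrow> a \<in> neg v"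
    and neg_box_pos: "maximal w \<Longrightarrow> \<^bold>\<not> \<^bold>\<box> a \<in> pos w \<Longrightarrow> \<exists>v. R w v \<and> a \<in> neg v"
    and neg_box_neg: "maximal w \<Longrightarrow> \<^bold>\<not> \<^bold>\<box> a \<in> neg w \<Longrightarrow> R w v \<Longrightarrow> a \<in> pos v"
    and neg_dia_pos: "maximal w \<Longrightarrow> \<^bold>\<not> \<^bold>\<diamond> a \<in> pos w \<Longrightarrow> R w v \<Longrightarrow> a \<in> neg v"
    and neg_dia_neg: "maximal w \<Longrightarrow> \<^bold>\<not> \<^bold>\<diamond> a \<in> neg w \<Longrightarrow> \<exists>v. R w v \<and> a \<in> pos v"
begin

abbreviation true_at :: "signed_set \<Rightarrow> fm \<Rightarrow> bool" where
  "true_at \<equiv> sat canonical_val R"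

text \<open>The twist rules decompose a negated formula by the connective below the negation, so the
  claims for \<open>a\<close> and for its negation go through one induction. Only implications are
  claimed, because \<open>w\<close> may contain a formula with neither sign.\<close>

lemma truth_lemma:
  "maximal w \<Longrightarrow>
    (a \<in> pos w \<longrightarrow> true_at w a) \<and> (a \<in> neg w \<longrightarrow> \<not> true_at w a) \<and>
    (\<^bold>\<not> a \<in> pos w \<longrightarrow> \<not> true_at w a) \<and> (\<^bold>\<not> a \<in> neg w \<longrightarrow> true_at w a)"
proof (induction a arbitrary: w)
  case (Var p)
  then show ?case using saturated_var[of w p] by (auto simp: canonical_val_def)
next
  case (And a b)
  show ?case using And.IH[OF And.prems] saturated_and[OF And.prems, of a b] by auto
next
  case (Or a b)
  show ?case using Or.IH[OF Or.prems] saturated_or[OF Or.prems, of a b] by auto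
next
  case (Imp a b)
  show ?case using Imp.IH[OF Imp.prems] saturated_imp[OF Imp.prems, of a b] by auto
next
  case (Neg a)
  show ?case using Neg.IH[OF Neg.prems] saturated_neg_neg[OF Neg.prems, of a] by auto
next
  case (Box a)
  then show ?case
    using maximal_R[of w] box_pos[of w a] box_neg[of w a] neg_box_pos[of w a] neg_box_neg[of w a]
    by simp blast
next
  case (Dia a)
  then show ?case
    using maximal_R[of w] dia_pos[of w a] dia_neg[of w a] neg_dia_pos[of w a] neg_dia_neg[of w a]
    by simp blast
qed

lemma underivable_countermodel:
  assumes "\<not> D \<Gamma> \<Delta>"
  obtains w where "maximal w" and "\<not> sat_seq canonical_val R w (\<Gamma> \<Rrightarrow> \<Delta>)"
proof -
  obtain w where "maximal w" "fset \<Gamma> \<subseteq> pos w" "fset \<Delta> \<subseteq> neg w"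
    by (rule maximal_of_sequent[OF assms])
  then show thesis using that[of w] truth_lemma[of w] by (auto simp: subset_iff)
qed

end

section \<open>Cut-free completeness of gTK and gTKT\<close>

locale K_derivability = twist_derivability +
  assumes box_K_right: "D (\<Gamma>1 |\<union>| \<Delta>2) (finsert a (\<Delta>1 |\<union>| \<Gamma>2)) \<Longrightarrow>
      D (\<^bold>\<box>\<^sub>s \<Gamma>1 |\<union>| \<^bold>\<not>\<^bold>\<diamond>\<^sub>s \<Gamma>2) (finsert (\<^bold>\<box> a) (\<^bold>\<diamond>\<^sub>s \<Delta>1 |\<union>| \<^bold>\<not>\<^bold>\<box>\<^sub>s \<Delta>2))"
    and dia_K_left: "D (finsert a (\<Gamma>1 |\<union>| \<Delta>2)) (\<Delta>1 |\<union>| \<Gamma>2) \<Longrightarrow>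
      D (finsert (\<^bold>\<diamond> a) (\<^bold>\<box>\<^sub>s \<Gamma>1 |\<union>| \<^bold>\<not>\<^bold>\<diamond>\<^sub>s \<Gamma>2)) (\<^bold>\<diamond>\<^sub>s \<Delta>1 |\<union>| \<^bold>\<not>\<^bold>\<box>\<^sub>s \<Delta>2)"
    and neg_box_K_left: "D (\<Gamma>1 |\<union>| \<Delta>2) (finsert a (\<Delta>1 |\<union>| \<Gamma>2)) \<Longrightarrow>
      D (finsert (\<^bold>\<not> \<^bold>\<box> a) (\<^bold>\<box>\<^sub>s \<Gamma>1 |\<union>| \<^bold>\<not>\<^bold>\<diamond>\<^sub>s \<Gamma>2)) (\<^bold>\<diamond>\<^sub>s \<Delta>1 |\<union>| \<^bold>\<not>\<^bold>\<box>\<^sub>s \<Delta>2)"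
    and neg_dia_K_right: "D (finsert a (\<Gamma>1 |\<union>| \<Delta>2)) (\<Delta>1 |\<union>| \<Gamma>2) \<Longrightarrow>
      D (\<^bold>\<box>\<^sub>s \<Gamma>1 |\<union>| \<^bold>\<not>\<^bold>\<diamond>\<^sub>s \<Gamma>2) (finsert (\<^bold>\<not> \<^bold>\<diamond> a) (\<^bold>\<diamond>\<^sub>s \<Delta>1 |\<union>| \<^bold>\<not>\<^bold>\<box>\<^sub>s \<Delta>2))"
begin

text \<open>The signed formulas required at every successor. They are those that the K rules leave
  as context in the premise: \<Gamma>1 and \<Delta>2 on the left, \<Delta>1 and \<Gamma>2 on the
  right.\<close>

definition unbox :: "signed_set \<Rightarrow> signed_set" where
  "unbox w = Pair True ` {a. \<^bold>\<box> a \<in> pos w \<or> \<^bold>\<not> \<^bold>\<box> a \<in> neg w} \<union>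
    Pair False ` {a. \<^bold>\<diamond> a \<in> neg w \<or> \<^bold>\<not> \<^bold>\<diamond> a \<in> pos w}"

text \<open>Relating sets that are not maximal to everything lets \<open>acc\<close> be reflexive on the whole type.\<close>

definition acc :: "signed_set \<Rightarrow> signed_set \<Rightarrow> bool" where
  "acc w v \<longleftrightarrow> (maximal w \<longrightarrow> maximal v \<and> unbox w \<subseteq> v)"

text \<open>A finite sequent drawn from \<open>unbox w\<close> is split according to the reason for
  which each formula is there. The parts may overlap, which is harmless for sets.\<close>

lemma unbox_modal_context:
  assumes "fset \<Gamma> \<subseteq> pos (unbox w)" and "fset \<Delta> \<subseteq> neg (unbox w)"
  obtains \<Gamma>1 \<Gamma>2 \<Delta>1 \<Delta>2 where "\<Gamma> = \<Gamma>1 |\<union>| \<Delta>2" and "\<Delta> = \<Delta>1 |\<union>| \<Gamma>2"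
    and "fset (\<^bold>\<box>\<^sub>s \<Gamma>1 |\<union>| \<^bold>\<not>\<^bold>\<diamond>\<^sub>s \<Gamma>2) \<subseteq> pos w" and "fset (\<^bold>\<diamond>\<^sub>s \<Delta>1 |\<union>| \<^bold>\<not>\<^bold>\<box>\<^sub>s \<Delta>2) \<subseteq> neg w"
proof (rule that)
  show "\<Gamma> = ffilter (\<lambda>a. \<^bold>\<box> a \<in> pos w) \<Gamma> |\<union>| ffilter (\<lambda>a. \<^bold>\<not> \<^bold>\<box> a \<in> neg w) \<Gamma>"
    using assms(1) by (auto simp: unbox_def)
  show "\<Delta> = ffilter (\<lambda>a. \<^bold>\<diamond> a \<in> neg w) \<Delta> |\<union>| ffilter (\<lambda>a. \<^bold>\<not> \<^bold>\<diamond> a \<in> pos w) \<Delta>"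
    using assms(2) by (auto simp: unbox_def)
qed auto

text \<open>If \<open>unbox w\<close> together with \<open>a\<close> on the right were inconsistent,
  a K rule would turn the derivation into one of a sequent drawn from \<open>w\<close>.\<close>

lemma successor_neg:
  assumes "maximal w" and "\<^bold>\<box> a \<in> neg w \<or> \<^bold>\<not> \<^bold>\<box> a \<in> pos w"
  shows "\<exists>v. acc w v \<and> a \<in> neg v"
proof -
  have "consistent (insert (False, a) (unbox w))"
    unfolding consistent_def
  proof (intro allI impI notI)
    fix \<Gamma> \<Delta>
    assume sub: "fset \<Gamma> \<subseteq> pos (insert (False, a) (unbox w))" "fset \<Delta> \<subseteq> neg (insert (False, a) (unbox w))"
      and D: "D \<Gamma> \<Delta>"
    have "fset \<Gamma> \<subseteq> pos (unbox w)" "fset (\<Delta> |-| {|a|}) \<subseteq> neg (unbox w)" using sub by auto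
    then obtain \<Gamma>1 \<Gamma>2 \<Delta>1 \<Delta>2 where eq: "\<Gamma> = \<Gamma>1 |\<union>| \<Delta>2" "\<Delta> |-| {|a|} = \<Delta>1 |\<union>| \<Gamma>2"
      and w: "fset (\<^bold>\<box>\<^sub>s \<Gamma>1 |\<union>| \<^bold>\<not>\<^bold>\<diamond>\<^sub>s \<Gamma>2) \<subseteq> pos w" "fset (\<^bold>\<diamond>\<^sub>s \<Delta>1 |\<union>| \<^bold>\<not>\<^bold>\<box>\<^sub>s \<Delta>2) \<subseteq> neg w"
      by (rule unbox_modal_context)
    \<comment> \<open>Weakening puts \<open>a\<close> on the right even if \<Delta> does not contain
      it.\<close>
    have "D (\<Gamma>1 |\<union>| \<Delta>2) (finsert a (\<Delta>1 |\<union>| \<Gamma>2))"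
      by (rule weaken[OF D]) (auto simp: eq(1) simp flip: eq(2))
    from assms(2) show False
    proof
      assume "\<^bold>\<box> a \<in> neg w"
      then show False using maximalD[OF assms(1)] box_K_right[OF \<open>D (\<Gamma>1 |\<union>| \<Delta>2) _\<close>] w
        by (metis finsert.rep_eq insert_subset)
    next
      assume "\<^bold>\<not> \<^bold>\<box> a \<in> pos w"
      then show False using maximalD[OF assms(1)] neg_box_K_left[OF \<open>D (\<Gamma>1 |\<union>| \<Delta>2) _\<close>] w
        by (metis finsert.rep_eq insert_subset)
    qed
  qed
  then obtain v where "insert (False, a) (unbox w) \<subseteq> v" "maximal v"
    by (rule extend_to_maximal)
  then show ?thesis unfolding acc_def by auto
qed

lemma successor_pos:
  assumes "maximal w" and "\<^bold>\<diamond> a \<in> pos w \<or> \<^bold>\<not> \<^bold>\<diamond> a \<in> neg w"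
  shows "\<exists>v. acc w v \<and> a \<in> pos v"
proof -
  have "consistent (insert (True, a) (unbox w))"
    unfolding consistent_def
  proof (intro allI impI notI)
    fix \<Gamma> \<Delta>
    assume sub: "fset \<Gamma> \<subseteq> pos (insert (True, a) (unbox w))" "fset \<Delta> \<subseteq> neg (insert (True, a) (unbox w))"
      and D: "D \<Gamma> \<Delta>"
    have "fset (\<Gamma> |-| {|a|}) \<subseteq> pos (unbox w)" "fset \<Delta> \<subseteq> neg (unbox w)" using sub by auto
    then obtain \<Gamma>1 \<Gamma>2 \<Delta>1 \<Delta>2 where eq: "\<Gamma> |-| {|a|} = \<Gamma>1 |\<union>| \<Delta>2" "\<Delta> = \<Delta>1 |\<union>| \<Gamma>2"
      and w: "fset (\<^bold>\<box>\<^sub>s \<Gamma>1 |\<union>| \<^bold>\<not>\<^bold>\<diamond>\<^sub>s \<Gamma>2) \<subseteq> pos w" "fset (\<^bold>\<diamond>\<^sub>s \<Delta>1 |\<union>| \<^bold>\<not>\<^bold>\<box>\<^sub>s \<Delta>2) \<subseteq> neg w"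
      by (rule unbox_modal_context)
    have "D (finsert a (\<Gamma>1 |\<union>| \<Delta>2)) (\<Delta>1 |\<union>| \<Gamma>2)"
      by (rule weaken[OF D]) (auto simp: eq(2) simp flip: eq(1))
    from assms(2) show False
    proof
      assume "\<^bold>\<diamond> a \<in> pos w"
      then show False using maximalD[OF assms(1)] dia_K_left[OF \<open>D (finsert a _) _\<close>] w
        by (metis finsert.rep_eq insert_subset)
    next
      assume "\<^bold>\<not> \<^bold>\<diamond> a \<in> neg w"
      then show False using maximalD[OF assms(1)] neg_dia_K_right[OF \<open>D (finsert a _) _\<close>] w
        by (metis finsert.rep_eq insert_subset)
    qed
  qed
  then obtain v where "insert (True, a) (unbox w) \<subseteq> v" "maximal v"
    by (rule extend_to_maximal)
  then show ?thesis unfolding acc_def by auto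
qed

sublocale canonical_model D acc
  by unfold_locales
    (use successor_pos successor_neg in \<open>auto simp: acc_def unbox_def subset_iff image_iff\<close>)

end

section \<open>Calculi as derivability relations, and completeness\<close>

lemma provable_axiom: "([], S) \<in> L \<Longrightarrow> provable L S"
  and provable_unary: "([P], S) \<in> L \<Longrightarrow> provable L P \<Longrightarrow> provable L S"
  and provable_binary: "([P, Q], S) \<in> L \<Longrightarrow> provable L P \<Longrightarrow> provable L Q \<Longrightarrow> provable L S"
  by (auto intro: provable.intros)

lemma provable_mono: "provable L S \<Longrightarrow> L \<subseteq> L' \<Longrightarrow> provable L' S"
  by (induction rule: provable.induct) (auto intro: provable.intros)

text \<open>Yields admissibility from elimination: a cut applied to cut-free provable premises is a
  proof in the calculus with cut.\<close>

lemma provable_extra_rule: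
  "(Ps, S) \<in> R \<Longrightarrow> \<forall>P \<in> set Ps. provable L P \<Longrightarrow> provable (L \<union> R) S"
  by (rule provable.intros[of Ps S]) (auto intro: provable_mono)

lemma K_derivability_provable:
  assumes "gTK_cutfree \<subseteq> L"
  shows "K_derivability (\<lambda>\<Gamma> \<Delta>. provable L (\<Gamma> \<Rrightarrow> \<Delta>))"
proof -
  note ax = provable_axiom[OF subsetD[OF assms]]
    and un = provable_unary[OF subsetD[OF assms]]
    and bin = provable_binary[OF subsetD[OF assms]]
  show ?thesis
    by unfold_locales
      ((rule ax, rule gTK_cutfree.intros) | (erule un[rotated], rule gTK_cutfree.intros) |
        (rule bin, rule gTK_cutfree.intros, assumption+))+
qed

text \<open>Validity is demanded only over models whose worlds are signed sets, the type in which
  the canonical model lives.\<close>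

lemma gTK_cutfree_complete:
  assumes "\<And>(V :: signed_set \<Rightarrow> nat \<Rightarrow> bool) R w. sat_seq V R w S"
  shows "provable gTK_cutfree S"
proof -
  interpret K_derivability "\<lambda>\<Gamma> \<Delta>. provable gTK_cutfree (\<Gamma> \<Rrightarrow> \<Delta>)"
    by (rule K_derivability_provable) simp
  show ?thesis using assms underivable_countermodel by (cases S) blast
qed

text \<open>Each T rule becomes a saturation property, and the four together say
  \<open>unbox w \<subseteq> w\<close>. Sets that are not maximal are covered by the definition of
  \<open>acc\<close>.\<close>

lemma (in K_derivability) acc_refl:
  assumes "\<And>a \<Gamma> \<Delta>. D (finsert a \<Gamma>) \<Delta> \<Longrightarrow> D (finsert (\<^bold>\<box> a) \<Gamma>) \<Delta>"
    and "\<And>a \<Gamma> \<Delta>. D \<Gamma> (finsert a \<Delta>) \<Longrightarrow> D \<Gamma> (finsert (\<^bold>\<diamond> a) \<Delta>)"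
    and "\<And>a \<Gamma> \<Delta>. D (finsert a \<Gamma>) \<Delta> \<Longrightarrow> D \<Gamma> (finsert (\<^bold>\<not> \<^bold>\<box> a) \<Delta>)"
    and "\<And>a \<Gamma> \<Delta>. D \<Gamma> (finsert a \<Delta>) \<Longrightarrow> D (finsert (\<^bold>\<not> \<^bold>\<diamond> a) \<Gamma>) \<Delta>"
  shows "acc w w"
  unfolding acc_def
proof
  assume w: "maximal w"
  have P: "a \<in> pos w" if "\<^bold>\<box> a \<in> pos w \<or> \<^bold>\<not> \<^bold>\<box> a \<in> neg w" for a
    using that not_closes_pos[OF w _ closes_pos[OF w], of "\<^bold>\<box> a" a]
      not_closes_neg[OF w _ closes_pos[OF w], of "\<^bold>\<not> \<^bold>\<box> a" a] assms(1,3) by auto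
  have N: "a \<in> neg w" if "\<^bold>\<diamond> a \<in> neg w \<or> \<^bold>\<not> \<^bold>\<diamond> a \<in> pos w" for a
    using that not_closes_neg[OF w _ closes_neg[OF w], of "\<^bold>\<diamond> a" a]
      not_closes_pos[OF w _ closes_neg[OF w], of "\<^bold>\<not> \<^bold>\<diamond> a" a] assms(2,4) by auto
  have "unbox w \<subseteq> w"
    unfolding unbox_def
  proof (intro Un_least image_subsetI)
    show "(True, a) \<in> w" if "a \<in> {a. \<^bold>\<box> a \<in> pos w \<or> \<^bold>\<not> \<^bold>\<box> a \<in> neg w}" for a
      using that P[of a] by simp
    show "(False, a) \<in> w" if "a \<in> {a. \<^bold>\<diamond> a \<in> neg w \<or> \<^bold>\<not> \<^bold>\<diamond> a \<in> pos w}" for a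
      using that N[of a] by simp
  qed
  with w show "maximal w \<and> unbox w \<subseteq> w" by simp
qed

lemma gTKT_cutfree_complete:
  assumes "\<And>(V :: signed_set \<Rightarrow> nat \<Rightarrow> bool) R w. (\<And>v. R v v) \<Longrightarrow> sat_seq V R w S"
  shows "provable gTKT_cutfree S"
proof -
  interpret K_derivability "\<lambda>\<Gamma> \<Delta>. provable gTKT_cutfree (\<Gamma> \<Rrightarrow> \<Delta>)"
    by (rule K_derivability_provable) (simp add: gTKT_cutfree_def)
  have "(Ps, S) \<in> T_rules \<Longrightarrow> (Ps, S) \<in> gTKT_cutfree" for Ps S
    by (simp add: gTKT_cutfree_def)
  note un = provable_unary[OF this]
  have "acc v v" for v
    by (rule acc_refl) (erule un[rotated], rule T_rules.intros)+
  then show ?thesis using assms underivable_countermodel by (cases S) blast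
qed

section \<open>Cut-free completeness of HTS5\<close>

lemma hts5_internal_weakening:
  assumes "provable HTS5_cutfree (\<Gamma> \<Rrightarrow> \<Delta> \<^bold>| H)"
  shows "provable HTS5_cutfree (\<Sigma> |\<union>| \<Gamma> \<Rrightarrow> \<Pi> |\<union>| \<Delta> \<^bold>| H)"
proof -
  have "provable HTS5_cutfree (\<Sigma> |\<union>| \<Gamma> \<Rrightarrow> \<Delta> \<^bold>| H)"
    by (induction \<Sigma>) (use assms in \<open>auto intro: provable_unary[OF HTS5_cutfree.in_we_left]\<close>)
  then show ?thesis
    by (induction \<Pi>) (auto intro: provable_unary[OF HTS5_cutfree.in_we_right])
qed

text \<open>A component is introduced with one of its formulas and then filled up by internal
  weakening; an empty component offers no formula to start from.\<close>

lemma hts5_external_weakening: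
  assumes "provable HTS5_cutfree H" and "({||} \<Rrightarrow> {||}) \<notin># K"
  shows "provable HTS5_cutfree (H + K)"
  using assms(2)
proof (induction K)
  case (add S K)
  then have IH: "provable HTS5_cutfree (H + K)" by simp
  obtain \<Gamma> \<Delta> where S: "S = (\<Gamma> \<Rrightarrow> \<Delta>)" by (cases S)
  with add.prems consider a where "a |\<in>| \<Gamma>" | a where "a |\<in>| \<Delta>" by auto
  then have "provable HTS5_cutfree (\<Gamma> \<Rrightarrow> \<Delta> \<^bold>| H + K)"
  proof cases
    case 1
    then show ?thesis
      using hts5_internal_weakening[OF provable_unary[OF HTS5_cutfree.ex_we_left[of _ a] IH],
          where \<Sigma> = \<Gamma> and \<Pi> = \<Delta>]
      by (simp add: finsert_absorb)
  next
    case 2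
    then show ?thesis
      using hts5_internal_weakening[OF provable_unary[OF HTS5_cutfree.ex_we_right[of _ a] IH],
          where \<Sigma> = \<Gamma> and \<Pi> = \<Delta>]
      by (simp add: finsert_absorb)
  qed
  then show ?case by (simp add: S)
qed (use assms(1) in simp)

text \<open>Merging a component with an equal one is external contraction, and merging an empty
  component into any other deletes it. Since \<open>K\<close> is nonempty, a partner always
  exists.\<close>

lemma hts5_absorb:
  assumes "provable HTS5_cutfree (N + K)" and "K \<noteq> {#}"
    and "set_mset N \<subseteq> insert ({||} \<Rrightarrow> {||}) (set_mset K)"
  shows "provable HTS5_cutfree K"
  using assms(1,3)
proof (induction N)
  case (add S N)
  obtain S' K' where K: "K = (S' \<^bold>| K')" and S: "S = S' \<or> S = ({||} \<Rrightarrow> {||})"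
    using add.prems(2) assms(2) by (metis insertE insert_subset multi_member_split multiset_cases set_mset_add_mset_insert)
  obtain \<Gamma> \<Delta> \<Sigma> \<Pi> where *: "S = (\<Sigma> \<Rrightarrow> \<Pi>)" "S' = (\<Gamma> \<Rrightarrow> \<Delta>)" by (metis sequent.exhaust)
  have "provable HTS5_cutfree (\<Sigma> \<Rrightarrow> \<Pi> \<^bold>| \<Gamma> \<Rrightarrow> \<Delta> \<^bold>| N + K')"
    using add.prems(1) by (simp add: K * add_mset_commute)
  then have "provable HTS5_cutfree (\<Sigma> |\<union>| \<Gamma> \<Rrightarrow> \<Pi> |\<union>| \<Delta> \<^bold>| N + K')"
    by (rule provable_unary[OF HTS5_cutfree.merge])
  then have "provable HTS5_cutfree (N + K)"
    using S by (auto simp: K *)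
  then show ?case using add by simp
qed simp

text \<open>Multisets over \<open>A\<close> may repeat components, so side hypersequents can be
  concatenated freely.\<close>

definition unprovable_set :: "sequent set \<Rightarrow> bool" where
  "unprovable_set A \<longleftrightarrow> (\<forall>H. set_mset H \<subseteq> A \<longrightarrow> \<not> provable HTS5_cutfree H)"

text \<open>A provable hypersequent drawn from \<open>H\<close> can be weakened by
  \<open>drop_empty H\<close>, which then absorbs all of its components.\<close>

lemma unprovable_set_components:
  assumes "drop_empty H \<noteq> {#}" and "\<not> provable HTS5_cutfree (drop_empty H)"
  shows "unprovable_set (set_mset H)"
  unfolding unprovable_set_def
proof (intro allI impI notI)
  fix M assume M: "set_mset M \<subseteq> set_mset H" "provable HTS5_cutfree M"
  have "provable HTS5_cutfree (M + drop_empty H)"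
    by (rule hts5_external_weakening[OF M(2)]) (simp add: drop_empty_def)
  then have "provable HTS5_cutfree (drop_empty H)"
    by (rule hts5_absorb) (use assms(1) M(1) in \<open>auto simp: drop_empty_def\<close>)
  with assms(2) show False by simp
qed

locale maximal_unprovable =
  fixes \<H> :: "sequent set"
  assumes unprovable: "unprovable_set \<H>"
    and maximality: "unprovable_set A \<Longrightarrow> \<H> \<subseteq> A \<Longrightarrow> A = \<H>"
begin

definition derivable :: "fm fset \<Rightarrow> fm fset \<Rightarrow> bool" where
  "derivable \<Gamma> \<Delta> \<longleftrightarrow> (\<exists>H. set_mset H \<subseteq> \<H> \<and> provable HTS5_cutfree (\<Gamma> \<Rrightarrow> \<Delta> \<^bold>| H))"

text \<open>By maximality, adding a sequent outside \<H> makes some hypersequent provable. It must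
  contain that sequent, and its repeated copies contract to one.\<close>

lemma derivable_iff: "derivable \<Gamma> \<Delta> \<longleftrightarrow> (\<Gamma> \<Rrightarrow> \<Delta>) \<notin> \<H>"
proof
  assume "derivable \<Gamma> \<Delta>"
  then show "(\<Gamma> \<Rrightarrow> \<Delta>) \<notin> \<H>"
    using unprovable unfolding derivable_def unprovable_set_def
    by (metis insert_subset set_mset_add_mset_insert)
next
  let ?S = "\<Gamma> \<Rrightarrow> \<Delta>"
  assume "?S \<notin> \<H>"
  then have "\<not> unprovable_set (insert ?S \<H>)"
    using maximality by blast
  then obtain M where M: "set_mset M \<subseteq> insert ?S \<H>" "provable HTS5_cutfree M"
    unfolding unprovable_set_def by blast
  have "?S \<in># M"
    using M unprovable unfolding unprovable_set_def by blast
  \<comment> \<open>\<open>N\<close> collects the surplus copies of \<open>?S\<close>, and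
    \<open>K\<close> the components from \<H>.\<close>
  obtain N K where NK: "M = N + (?S \<^bold>| K)" and N: "set_mset N \<subseteq> {?S}" and K: "set_mset K \<subseteq> \<H>"
  proof
    let ?N = "{# T \<in># M. T = ?S #} - {# ?S #}" and ?K = "{# T \<in># M. T \<noteq> ?S #}"
    have "?S \<in># {# T \<in># M. T = ?S #}"
      using \<open>?S \<in># M\<close> by simp
    then have "{# T \<in># M. T = ?S #} = (?S \<^bold>| ?N)"
      by (metis insert_DiffM)
    then show "M = ?N + (?S \<^bold>| ?K)"
      by (metis multiset_partition[of M "\<lambda>T. T = ?S"] union_mset_add_mset_left
          union_mset_add_mset_right)
    show "set_mset ?N \<subseteq> {?S}" by (auto dest: in_diffD)
    show "set_mset ?K \<subseteq> \<H>" using M(1) by auto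
  qed
  have "provable HTS5_cutfree (?S \<^bold>| K)"
    by (rule hts5_absorb[of N]) (use M(2) NK N in auto)
  with K show "derivable \<Gamma> \<Delta>"
    unfolding derivable_def by metis
qed

section \<open>Hypersequent rules as sequent rules relative to \<H>\<close>

lemma derivable_axiom:
  "([], {# \<Gamma> \<Rrightarrow> \<Delta> #}) \<in> HTS5_cutfree \<Longrightarrow> derivable \<Gamma> \<Delta>"
  unfolding derivable_def by (intro exI[of _ "{#}"]) (auto intro: provable_axiom)

lemma derivable_unary:
  "(\<And>H. ([\<Gamma>' \<Rrightarrow> \<Delta>' \<^bold>| H], \<Gamma> \<Rrightarrow> \<Delta> \<^bold>| H) \<in> HTS5_cutfree) \<Longrightarrow> derivable \<Gamma>' \<Delta>' \<Longrightarrow> derivable \<Gamma> \<Delta>"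
  unfolding derivable_def by (blast intro: provable_unary)

lemma derivable_binary:
  assumes "\<And>H G. ([\<Gamma>1 \<Rrightarrow> \<Delta>1 \<^bold>| H, \<Gamma>2 \<Rrightarrow> \<Delta>2 \<^bold>| G], \<Gamma> \<Rrightarrow> \<Delta> \<^bold>| H + G) \<in> HTS5_cutfree"
    and "derivable \<Gamma>1 \<Delta>1" and "derivable \<Gamma>2 \<Delta>2"
  shows "derivable \<Gamma> \<Delta>"
proof -
  obtain H G where *: "set_mset H \<subseteq> \<H>" "set_mset G \<subseteq> \<H>"
    "provable HTS5_cutfree (\<Gamma>1 \<Rrightarrow> \<Delta>1 \<^bold>| H)" "provable HTS5_cutfree (\<Gamma>2 \<Rrightarrow> \<Delta>2 \<^bold>| G)"
    using assms(2,3) unfolding derivable_def by blast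
  then show ?thesis
    unfolding derivable_def using provable_binary[OF assms(1) *(3,4)]
    by (intro exI[of _ "H + G"]) auto
qed

text \<open>If the second component is underivable, it belongs to \<H> and counts as a side
  component in deriving the first.\<close>

lemma derivable_spread:
  assumes "\<And>H. ([\<Gamma>' \<Rrightarrow> \<Delta>' \<^bold>| H], \<Sigma> \<Rrightarrow> \<Pi> \<^bold>| \<Gamma> \<Rrightarrow> \<Delta> \<^bold>| H) \<in> HTS5_cutfree"
    and "derivable \<Gamma>' \<Delta>'"
  shows "derivable \<Sigma> \<Pi> \<or> derivable \<Gamma> \<Delta>"
proof (rule ccontr)
  assume *: "\<not> ?thesis"
  obtain H where "set_mset H \<subseteq> \<H>" "provable HTS5_cutfree (\<Gamma>' \<Rrightarrow> \<Delta>' \<^bold>| H)"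
    using assms(2) unfolding derivable_def by blast
  then have "derivable \<Sigma> \<Pi>"
    unfolding derivable_def using provable_unary[OF assms(1)] *
    by (intro exI[of _ "\<Gamma> \<Rrightarrow> \<Delta> \<^bold>| H"]) (auto simp: derivable_iff)
  with * show False by simp
qed

sublocale twist_derivability derivable
proof unfold_locales
  show "derivable {|\<^bold>\<not> Var p, Var p|} {||}" "derivable {||} {|\<^bold>\<not> Var p, Var p|}" for p
    using HTS5_cutfree.init_left[THEN derivable_axiom] HTS5_cutfree.init_right[THEN derivable_axiom]
    by (simp_all add: finsert_commute)
qed ((rule derivable_axiom, rule HTS5_cutfree.intros) |
    (erule derivable_unary[rotated], rule HTS5_cutfree.intros) |
    (rule derivable_binary, rule HTS5_cutfree.intros, assumption+))+

text \<open>Otherwise \<open>a\<close> closes \<open>v\<close>, and by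
  \<open>derivable_spread\<close> either \<Sigma>, \<Pi> or a sequent drawn from \<open>v\<close> is
  derivable. Both are excluded.\<close>

lemma spread_pos:
  assumes "maximal v" and "\<not> derivable \<Sigma> \<Pi>"
    and rule: "\<And>\<Gamma> \<Delta> H. ([finsert a \<Gamma> \<Rrightarrow> \<Delta> \<^bold>| H], \<Sigma> \<Rrightarrow> \<Pi> \<^bold>| \<Gamma> \<Rrightarrow> \<Delta> \<^bold>| H) \<in> HTS5_cutfree"
  shows "a \<in> pos v"
proof (rule ccontr)
  assume "a \<notin> pos v"
  then obtain \<Gamma> \<Delta> where *: "fset \<Gamma> \<subseteq> pos v" "fset \<Delta> \<subseteq> neg v" "derivable (finsert a \<Gamma>) \<Delta>"
    using closes_pos[OF assms(1), of a] unfolding closes_def by auto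
  then show False
    using derivable_spread[OF rule *(3)] assms(2) maximalD[OF assms(1)] by blast
qed

lemma spread_neg:
  assumes "maximal v" and "\<not> derivable \<Sigma> \<Pi>"
    and rule: "\<And>\<Gamma> \<Delta> H. ([\<Gamma> \<Rrightarrow> finsert a \<Delta> \<^bold>| H], \<Sigma> \<Rrightarrow> \<Pi> \<^bold>| \<Gamma> \<Rrightarrow> \<Delta> \<^bold>| H) \<in> HTS5_cutfree"
  shows "a \<in> neg v"
proof (rule ccontr)
  assume "a \<notin> neg v"
  then obtain \<Gamma> \<Delta> where *: "fset \<Gamma> \<subseteq> pos v" "fset \<Delta> \<subseteq> neg v" "derivable \<Gamma> (finsert a \<Delta>)"
    using closes_neg[OF assms(1), of a] unfolding closes_def by auto
  then show False
    using derivable_spread[OF rule *(3)] assms(2) maximalD[OF assms(1)] by blast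
qed

text \<open>Underivability of a one-formula sequent no longer mentions \<open>w\<close>; this is how
  modal information passes from one maximal set to all others.\<close>

lemma maximal_singleton:
  assumes "maximal w"
  shows "a \<in> pos w \<Longrightarrow> \<not> derivable {|a|} {||}" and "a \<in> neg w \<Longrightarrow> \<not> derivable {||} {|a|}"
  using maximalD[OF assms, of "{|a|}" "{||}"] maximalD[OF assms, of "{||}" "{|a|}"] by auto

lemma witness_pos: "\<not> derivable {|a|} {||} \<Longrightarrow> \<exists>v. maximal v \<and> a \<in> pos v"
  and witness_neg: "\<not> derivable {||} {|a|} \<Longrightarrow> \<exists>v. maximal v \<and> a \<in> neg v"
  by (metis finsertI1 maximal_of_sequent subsetD)+

sublocale canonical_model derivable "\<lambda>_. maximal"
proof unfold_locales
  fix w v a assume w: "maximal w" and v: "maximal v"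
  show "a \<in> pos v" if "\<^bold>\<box> a \<in> pos w"
    by (rule spread_pos[OF v maximal_singleton(1)[OF w that]]) (rule HTS5_cutfree.box_left)
  show "a \<in> neg v" if "\<^bold>\<diamond> a \<in> neg w"
    by (rule spread_neg[OF v maximal_singleton(2)[OF w that]])
      (subst add_mset_commute, rule HTS5_cutfree.dia_right)
  show "a \<in> pos v" if "\<^bold>\<not> \<^bold>\<box> a \<in> neg w"
    by (rule spread_pos[OF v maximal_singleton(2)[OF w that]])
      (subst add_mset_commute, rule HTS5_cutfree.neg_box_right)
  show "a \<in> neg v" if "\<^bold>\<not> \<^bold>\<diamond> a \<in> pos w"
    by (rule spread_neg[OF v maximal_singleton(1)[OF w that]]) (rule HTS5_cutfree.neg_dia_left)
next
  fix w a assume w: "maximal w"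
  \<comment> \<open>The existential conditions read a rule on one-formula components backwards: the
    underivable premise extends to a maximal set.\<close>
  show "\<exists>v. maximal v \<and> a \<in> neg v" if "\<^bold>\<box> a \<in> neg w"
    using maximal_singleton(2)[OF w that] derivable_unary[OF HTS5_cutfree.box_right] witness_neg
    by blast
  show "\<exists>v. maximal v \<and> a \<in> pos v" if "\<^bold>\<diamond> a \<in> pos w"
    using maximal_singleton(1)[OF w that] derivable_unary[OF HTS5_cutfree.dia_left] witness_pos
    by blast
  show "\<exists>v. maximal v \<and> a \<in> neg v" if "\<^bold>\<not> \<^bold>\<box> a \<in> pos w"
    using maximal_singleton(1)[OF w that] derivable_unary[OF HTS5_cutfree.neg_box_left] witness_neg
    by blast
  show "\<exists>v. maximal v \<and> a \<in> pos v" if "\<^bold>\<not> \<^bold>\<diamond> a \<in> neg w"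
    using maximal_singleton(2)[OF w that] derivable_unary[OF HTS5_cutfree.neg_dia_right] witness_pos
    by blast
qed

text \<open>The members of \<H> may fail at different worlds of this one model, as the failure of a
  hypersequent permits.\<close>

lemma refuted:
  assumes "S \<in> \<H>"
  shows "\<exists>w \<in> Collect maximal. \<not> sat_seq canonical_val (\<lambda>_ v. v \<in> Collect maximal) w S"
proof -
  obtain \<Gamma> \<Delta> where S: "S = (\<Gamma> \<Rrightarrow> \<Delta>)" by (cases S)
  then have "\<not> derivable \<Gamma> \<Delta>" using assms by (simp add: derivable_iff)
  then obtain w where "maximal w" "\<not> sat_seq canonical_val (\<lambda>_. maximal) w (\<Gamma> \<Rrightarrow> \<Delta>)"
    by (rule underivable_countermodel)
  then show ?thesis using S by auto
qed

end

lemma HTS5_cutfree_complete: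
  assumes valid: "\<And>(V :: signed_set \<Rightarrow> nat \<Rightarrow> bool) W. sat_hyp V W H"
  shows "provable HTS5_cutfree (drop_empty H)"
proof (rule ccontr)
  assume unprovable: "\<not> provable HTS5_cutfree (drop_empty H)"
  have "drop_empty H \<noteq> {#}"
  proof
    assume "drop_empty H = {#}"
    then have "\<forall>S \<in># H. S = ({||} \<Rrightarrow> {||})"
      by (simp add: drop_empty_def filter_mset_eq_conv)
    \<comment> \<open>An empty component fails at every world, so any model with a world refutes a
      hypersequent consisting of empty components only.\<close>
    moreover obtain S where "S \<in># H" "sat_seq (\<lambda>_ _. True) (\<lambda>_ _. True) ({} :: signed_set) S"
      using valid[of "\<lambda>_ _. True" UNIV] by (auto simp: sat_hyp_def)
    ultimately show False by auto
  qed
  from unprovable_set_components[OF this unprovable]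
  obtain \<H> where \<H>: "set_mset H \<subseteq> \<H>" "unprovable_set \<H>"
    "\<And>A. unprovable_set A \<Longrightarrow> \<H> \<subseteq> A \<Longrightarrow> A = \<H>"
  proof (rule finite_character_maximal[rotated 2])
    show "unprovable_set A" if "unprovable_set B" "A \<subseteq> B" for A B
      using that unfolding unprovable_set_def by blast
    \<comment> \<open>A hypersequent has finitely many components, hence it is drawn from a finite
      subset.\<close>
    show "unprovable_set A" if "\<And>F. finite F \<Longrightarrow> F \<subseteq> A \<Longrightarrow> unprovable_set F" for A
      using that unfolding unprovable_set_def by (metis finite_set_mset order_refl)
    fix M
    assume "set_mset H \<subseteq> M" "unprovable_set M" "\<And>B. unprovable_set B \<Longrightarrow> M \<subseteq> B \<Longrightarrow> B = M"
    then show thesis by (rule that)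
  qed
  interpret maximal_unprovable \<H> by unfold_locales (use \<H> in auto)
  show False
    using valid[of canonical_val "Collect maximal"] refuted \<H>(1) unfolding sat_hyp_def by blast
qed

section \<open>Cut elimination from soundness and cut-free completeness\<close>

theorem theorem5p4:
  shows "(admissible gTK_cut gTK_cutfree \<and>
          (\<forall>S. provable gTK S \<longrightarrow> provable gTK_cutfree S)) \<and>
         (admissible gTK_cut gTKT_cutfree \<and>
          (\<forall>S. provable gTKT S \<longrightarrow> provable gTKT_cutfree S)) \<and>
         ((\<forall>(Ps, H) \<in> HTS5_cut.
             (\<forall>P \<in> set Ps. provable HTS5_cutfree P) \<longrightarrow> provable HTS5_cutfree (drop_empty H)) \<and>
          (\<forall>H. provable HTS5 H \<longrightarrow> provable HTS5_cutfree (drop_empty H)))"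
proof -
  have K: "provable gTK_cutfree S" if "provable gTK S" for S
    by (rule gTK_cutfree_complete) (rule gTK_sound[OF that])
  have KT: "provable gTKT_cutfree S" if "provable gTKT S" for S
    by (rule gTKT_cutfree_complete) (rule gTKT_sound[OF that])
  have S5: "provable HTS5_cutfree (drop_empty H)" if "provable HTS5 H" for H
    by (rule HTS5_cutfree_complete) (rule HTS5_sound[OF that])
  have "admissible gTK_cut gTK_cutfree"
    unfolding admissible_def using K provable_extra_rule[of _ _ gTK_cut gTK_cutfree]
    by (auto simp: gTK_def)
  moreover have "admissible gTK_cut gTKT_cutfree"
    unfolding admissible_def using KT provable_extra_rule[of _ _ gTK_cut gTKT_cutfree]
    by (auto simp: gTKT_def)
  moreover have "\<forall>(Ps, H) \<in> HTS5_cut.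
      (\<forall>P \<in> set Ps. provable HTS5_cutfree P) \<longrightarrow> provable HTS5_cutfree (drop_empty H)"
    using S5 provable_extra_rule[of _ _ HTS5_cut HTS5_cutfree] by (auto simp: HTS5_def)
  ultimately show ?thesis using K KT S5 by simp
qed

end
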